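(* There is a constant $\alpha>0$ such that, with probability tending to $1$ as $n\to\infty$, when $\sigma$ is chosen uniformly at random among the permutations of $\{1,\dots,n\}$, every resolution refutation of the unsatisfiable CNF formula $\mathsf{rPar}(n,\sigma)$ contains at least $2^{\alpha n}$ clauses.
   Context: Literals are Boolean variables or their negations. For literals $y_1,\dots,y_k$, $\mathsf{xor}(y_1,\dots,y_k)$ denotes the CNF consisting of all $2^{k-1}$ clauses on exactly the literals $y_1,\dots,y_k$ (each occurring either as itself or negated) such that the number of unnegated $y_j$'s in the clause is odd when $k$ is odd and even when $k$ is even; it is satisfied exactly when $y_1\oplus\dots\oplus y_k=0$. For a list of $m\ge 4$ literals $(y_1,\dots,y_m)$ and fresh variables $t_1,\dots,t_{m-3}$, the linear encoding is $\mathsf{xor}(y_1,y_2,t_1)\wedge\bigwedge_{j=1}^{m-4}\mathsf{xor}(t_j,y_{j+2},t_{j+1})\wedge\mathsf{xor}(t_{m-3},y_{m-1},y_m)$; for a set $X=\{x_1,\dots,x_n\}$, a set $T$ of fresh variables and a permutation $\sigma$ of $\{1,\dots,n\}$, $\mathsf{Parity}(X,T,\sigma)$ is this encoding applied to the list $(x_{\sigma(1)},\dots,x_{\sigma(n)})$ with Tseitin variables from $T$. For $n\ge 4$, let $X=\{x_1,\dots,x_n\}$ be variables, $X'=\{x_1,\dots,x_{n-1},\bar x_n\}$ (with $\bar x_n$ in position $n$), and $S,T$ disjoint sets of fresh variables. Then $\mathsf{rPar}(n,\sigma)=\mathsf{Parity}(X,S,\mathrm{id})\wedge\mathsf{Parity}(X',T,\sigma)$,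 which is unsatisfiable (it asserts that the sum of the $x_i$ is both even and odd). Resolution derives $C_1\vee C_2$ from $C_1\vee x$ and $C_2\vee\bar x$; a refutation is a derivation of the empty clause, and its length is the number of clauses in it. *)

theory Defs
  imports "HOL-Probability.Probability" "HOL-Combinatorics.Permutations"
begin

section \<open>Clauses and resolution\<close>

datatype 'v literal = Pos 'v | Neg 'v

fun neg_lit :: "'v literal \<Rightarrow> 'v literal" where
  "neg_lit (Pos v) = Neg v"
| "neg_lit (Neg v) = Pos v"

type_synonym 'v clause = "'v literal set"
type_synonym 'v cnf = "'v clause set"

fun lit_true :: "('v \<Rightarrow> bool) \<Rightarrow> 'v literal \<Rightarrow> bool" where
  "lit_true a (Pos v) = a v"
| "lit_true a (Neg v) = (\<not> a v)"

definition satisfies :: "('v \<Rightarrow> bool) \<Rightarrow> 'v cnf \<Rightarrow> bool" where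
  "satisfies a F \<longleftrightarrow> (\<forall>C\<in>F. \<exists>l\<in>C. lit_true a l)"

text \<open>
  The premises are read literally as \<open>C1 \<or> x\<close> and \<open>C2 \<or> \<not>x\<close>. As clauses are sets,
  \<open>C1\<close> may be chosen with or without the literal \<open>x\<close>, so deleting the pivot from both
  premises is one instance of the rule.
\<close>
definition resolvent :: "'v clause \<Rightarrow> 'v clause \<Rightarrow> 'v clause \<Rightarrow> bool" where
  "resolvent A B C \<longleftrightarrow>
     (\<exists>C1 C2 x. A = insert (Pos x) C1 \<and> B = insert (Neg x) C2 \<and> C = C1 \<union> C2)"

definition resolution_derivation :: "'v cnf \<Rightarrow> 'v clause list \<Rightarrow> bool" where
  "resolution_derivation F \<pi> \<longleftrightarrow>
     (\<forall>i<length \<pi>. \<pi> ! i \<in> F \<or> (\<exists>j<i. \<exists>k<i. resolvent (\<pi> ! j) (\<pi> ! k) (\<pi> ! i)))"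

definition resolution_refutation :: "'v cnf \<Rightarrow> 'v clause list \<Rightarrow> bool" where
  "resolution_refutation F \<pi> \<longleftrightarrow>
     resolution_derivation F \<pi> \<and> \<pi> \<noteq> [] \<and> last \<pi> = {}"

section \<open>Parity encodings\<close>

definition signed :: "bool list \<Rightarrow> 'v literal list \<Rightarrow> 'v clause" where
  "signed bs ys = set (map2 (\<lambda>b y. if b then neg_lit y else y) bs ys)"

text \<open>
  In \<open>signed bs ys\<close>, \<open>True\<close> marks a negated position. An odd number of negated
  positions means that the number of unnegated ones is even for odd \<open>length ys\<close> and odd for
  even \<open>length ys\<close>; this is the choice for which the formula says that the exclusive or of
  \<open>ys\<close> is 0 (\<open>satisfies_xor_cnf\<close>). The choice with the two parities exchanged says, for
  three literals, that the exclusive or is 1. It arises from this one by negating all variables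
  (\<open>neg_xor_cnf\<close>), which preserves the lengths of refutations
  (\<open>resolution_refutation_neg_iff\<close>).
\<close>
definition xor_cnf :: "'v literal list \<Rightarrow> 'v cnf" where
  "xor_cnf ys = {signed bs ys | bs. length bs = length ys \<and> odd (count_list bs True)}"

text \<open>The list \<open>y 1, \<dots>, y m\<close> and the variables \<open>t 1, \<dots>, t (m - 3)\<close> are
  indexed from 1; meaningful for \<open>m \<ge> 4\<close> only.\<close>
definition linear_xor :: "nat \<Rightarrow> (nat \<Rightarrow> 'v literal) \<Rightarrow> (nat \<Rightarrow> 'v) \<Rightarrow> 'v cnf" where
  "linear_xor m y t =
     xor_cnf [y 1, y 2, Pos (t 1)] \<union>
     (\<Union>j\<in>{1..m-4}. xor_cnf [Pos (t j), y (j + 2), Pos (t (j + 1))]) \<union>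
     xor_cnf [Pos (t (m - 3)), y (m - 1), y m]"

definition Parity :: "nat \<Rightarrow> (nat \<Rightarrow> 'v literal) \<Rightarrow> (nat \<Rightarrow> 'v) \<Rightarrow> (nat \<Rightarrow> nat) \<Rightarrow> 'v cnf" where
  "Parity n x t \<sigma> = linear_xor n (\<lambda>i. x (\<sigma> i)) t"

datatype par_var = XVar nat | SVar nat | TVar nat

definition rPar :: "nat \<Rightarrow> (nat \<Rightarrow> nat) \<Rightarrow> par_var cnf" where
  "rPar n \<sigma> =
     Parity n (\<lambda>i. Pos (XVar i)) SVar id \<union>
     Parity n (\<lambda>i. if i = n then Neg (XVar i) else Pos (XVar i)) TVar \<sigma>"

section \<open>Sanity checks\<close>

lemma neg_lit_neg_lit [simp]: "neg_lit (neg_lit l) = l"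
  by (cases l) auto

lemma lit_true_neg_lit [simp]: "lit_true a (neg_lit l) \<longleftrightarrow> \<not> lit_true a l"
  by (cases l) auto

lemma signed_falsified_iff:
  "length bs = length ys \<Longrightarrow>
     \<not> (\<exists>l\<in>signed bs ys. lit_true a l) \<longleftrightarrow> bs = map (lit_true a) ys"
  by (induction bs ys rule: list_induct2) (auto simp: signed_def)

lemma satisfies_xor_cnf:
  "satisfies a (xor_cnf ys) \<longleftrightarrow> even (\<Sum>y\<leftarrow>ys. of_bool (lit_true a y) :: nat)"
proof -
  have count: "count_list (map (lit_true a) ys) True = (\<Sum>y\<leftarrow>ys. of_bool (lit_true a y))"
    by (induction ys) auto
  have "satisfies a (xor_cnf ys) \<longleftrightarrow>
      (\<forall>bs. length bs = length ys \<and> odd (count_list bs True) \<longrightarrow> bs \<noteq> map (lit_true a) ys)"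
    unfolding satisfies_def xor_cnf_def using signed_falsified_iff[of _ ys a] by blast
  also have "\<dots> \<longleftrightarrow> even (count_list (map (lit_true a) ys) True)"
    using length_map[of "lit_true a" ys] by blast
  finally show ?thesis by (simp add: count)
qed

lemma neg_signed:
  "length bs = length ys \<Longrightarrow> neg_lit ` signed bs ys = signed (map Not bs) ys"
  by (induction bs ys rule: list_induct2) (auto simp: signed_def)

lemma neg_xor_cnf:
  assumes "odd (length ys)"
  shows "(`) neg_lit ` xor_cnf ys =
    {signed bs ys | bs. length bs = length ys \<and> odd (count_list bs False)}"
proof -
  have c: "count_list (map Not bs) False = count_list bs True"
          "count_list (map Not bs) True = count_list bs False" for bs
    by (induction bs) auto
  have i: "map Not (map Not bs) = bs" for bs
    by (induction bs) auto
  show ?thesis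
  proof (intro equalityI subsetI)
    fix C assume "C \<in> (`) neg_lit ` xor_cnf ys"
    then obtain bs where bs: "length bs = length ys" "odd (count_list bs True)"
      "C = neg_lit ` signed bs ys"
      unfolding xor_cnf_def by auto
    then have "C = signed (map Not bs) ys \<and> length (map Not bs) = length ys \<and>
      odd (count_list (map Not bs) False)"
      by (simp add: neg_signed c)
    then show "C \<in> {signed bs ys | bs. length bs = length ys \<and> odd (count_list bs False)}"
      by blast
  next
    fix C assume "C \<in> {signed bs ys | bs. length bs = length ys \<and> odd (count_list bs False)}"
    then obtain bs where bs: "length bs = length ys" "odd (count_list bs False)"
      "C = signed bs ys" by auto
    then have "C = neg_lit ` signed (map Not bs) ys"
      using neg_signed[of "map Not bs" ys] i[of bs] by simp
    moreover have "signed (map Not bs) ys \<in> xor_cnf ys"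
      using bs c unfolding xor_cnf_def by (auto intro!: exI[of _ "map Not bs"])
    ultimately show "C \<in> (`) neg_lit ` xor_cnf ys" by blast
  qed
qed

lemma resolvent_neg:
  assumes "resolvent A B C"
  shows "resolvent (neg_lit ` B) (neg_lit ` A) (neg_lit ` C)"
proof -
  obtain C1 C2 x where "A = insert (Pos x) C1" "B = insert (Neg x) C2" "C = C1 \<union> C2"
    using assms unfolding resolvent_def by blast
  then show ?thesis
    unfolding resolvent_def
    by (intro exI[of _ "neg_lit ` C2"] exI[of _ "neg_lit ` C1"] exI[of _ x]) auto
qed

lemma resolution_refutation_neg:
  assumes "resolution_refutation F \<pi>"
  shows "resolution_refutation ((`) neg_lit ` F) (map ((`) neg_lit) \<pi>)"
proof -
  have "map ((`) neg_lit) \<pi> ! i \<in> (`) neg_lit ` F \<or>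
      (\<exists>j<i. \<exists>k<i. resolvent (map ((`) neg_lit) \<pi> ! j) (map ((`) neg_lit) \<pi> ! k)
        (map ((`) neg_lit) \<pi> ! i))"
    if i: "i < length \<pi>" for i
  proof -
    from assms i consider "\<pi> ! i \<in> F"
      | j k where "j < i" "k < i" "resolvent (\<pi> ! j) (\<pi> ! k) (\<pi> ! i)"
      unfolding resolution_refutation_def resolution_derivation_def by blast
    then show ?thesis
    proof cases
      case 1
      then show ?thesis using i by simp
    next
      case 2
      then have "resolvent (map ((`) neg_lit) \<pi> ! k) (map ((`) neg_lit) \<pi> ! j)
          (map ((`) neg_lit) \<pi> ! i)"
        using resolvent_neg i by simp
      with 2 show ?thesis by blast
    qed
  qed
  then show ?thesis
    using assms unfolding resolution_refutation_def resolution_derivation_def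
    by (simp add: last_map)
qed

lemma resolution_refutation_neg_iff:
  "resolution_refutation ((`) neg_lit ` F) (map ((`) neg_lit) \<pi>) \<longleftrightarrow> resolution_refutation F \<pi>"
proof
  have i: "neg_lit ` neg_lit ` C = C" for C :: "'a clause"
    by (simp add: image_image)
  assume "resolution_refutation ((`) neg_lit ` F) (map ((`) neg_lit) \<pi>)"
  from resolution_refutation_neg[OF this] show "resolution_refutation F \<pi>"
    by (simp add: i image_image[of "(`) neg_lit"] comp_def)
qed (rule resolution_refutation_neg)

lemma satisfies_Un: "satisfies a (F \<union> G) \<longleftrightarrow> satisfies a F \<and> satisfies a G"
  unfolding satisfies_def by blast

lemma satisfies_UN: "satisfies a (\<Union>j\<in>J. F j) \<longleftrightarrow> (\<forall>j\<in>J. satisfies a (F j))"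
  unfolding satisfies_def by blast

lemma satisfies_linear_xorD:
  assumes "m \<ge> 4" and "satisfies a (linear_xor m y t)"
  shows "even (\<Sum>i=1..m. of_bool (lit_true a (y i)) :: nat)"
proof -
  define v where "v i = (of_bool (lit_true a (y i)) :: nat)" for i
  define u where "u j = (of_bool (a (t j)) :: nat)" for j
  have first: "even (v 1 + v 2 + u 1)"
    and mid: "\<And>j. 1 \<le> j \<Longrightarrow> j \<le> m - 4 \<Longrightarrow> even (u j + v (j + 2) + u (j + 1))"
    and last: "even (u (m - 3) + v (m - 1) + v m)"
    using assms(2) unfolding linear_xor_def satisfies_Un satisfies_UN satisfies_xor_cnf
    by (auto simp: add.assoc v_def u_def simp del: even_add)
  have step: "even ((\<Sum>i=1..j+1. v i) + u j)" if "1 \<le> j" "j \<le> m - 3" for j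
    using that
  proof (induction j rule: dec_induct)
    case base
    then show ?case using first by (simp add: numeral_2_eq_2 del: even_add)
  next
    case (step j)
    then have "even ((\<Sum>i=1..j+1. v i) + u j)" "even (u j + v (j + 2) + u (j + 1))"
      using mid[of j] assms(1) by auto
    moreover have "(\<Sum>i=1..Suc j+1. v i) = (\<Sum>i=1..j+1. v i) + v (j + 2)"
      by simp
    ultimately show ?case by (metis Suc_eq_plus1 even_add)
  qed
  obtain k where k: "m = k + 4" using assms(1) by (metis add.commute le_iff_add)
  have "even ((\<Sum>i=1..k+2. v i) + u (k + 1))"
    using step[of "k + 1"] k by simp
  moreover have "even (u (k + 1) + v (k + 3) + v (k + 4))"
    using last k by (simp add: numeral_eq_Suc)
  moreover have "(\<Sum>i=1..m. v i) = (\<Sum>i=1..k+2. v i) + v (k + 3) + v (k + 4)"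
    unfolding k by (simp add: numeral_eq_Suc)
  ultimately have "even (\<Sum>i=1..m. v i)" by presburger
  then show ?thesis by (simp only: v_def)
qed

lemma rPar_unsatisfiable:
  assumes "n \<ge> 4" and "\<sigma> permutes {1..n}"
  shows "\<not> satisfies a (rPar n \<sigma>)"
proof
  assume "satisfies a (rPar n \<sigma>)"
  then have sat: "satisfies a (linear_xor n (\<lambda>i. Pos (XVar (id i))) SVar)"
    "satisfies a (linear_xor n
       (\<lambda>i. if \<sigma> i = n then Neg (XVar (\<sigma> i)) else Pos (XVar (\<sigma> i))) TVar)"
    by (auto simp: rPar_def Parity_def satisfies_Un)
  define g where "g i = (of_bool (lit_true a (if i = n then Neg (XVar i) else Pos (XVar i))) :: nat)" for i
  define f where "f i = (of_bool (a (XVar i)) :: nat)" for i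
  have 1: "even (\<Sum>i=1..n. f i)"
    using satisfies_linear_xorD[OF assms(1) sat(1)] by (simp add: f_def)
  have "even (\<Sum>i=1..n. g (\<sigma> i))"
    using satisfies_linear_xorD[OF assms(1) sat(2)] by (simp add: g_def)
  moreover have "(\<Sum>i=1..n. g (\<sigma> i)) = (\<Sum>i=1..n. g i)"
    using sum.permute[OF assms(2), of g] by (simp add: comp_def)
  ultimately have 2: "even (\<Sum>i=1..n. g i)" by simp
  have split: "{1..n} = insert n {1..<n}" using assms(1) by auto
  have "(\<Sum>i\<in>{1..<n}. f i) = (\<Sum>i\<in>{1..<n}. g i)"
    by (intro sum.cong) (auto simp: f_def g_def)
  moreover have "f n + g n = 1" by (simp add: f_def g_def)
  ultimately show False using 1 2 unfolding split by simp presburger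
qed

end

theory Submission
  imports Defs
begin

text \<open>
  The formula is a system of linear equations over GF(2), one per triple of the two chains, in which
  every variable occurs in two equations. Up to exponentially small probability the underlying
  graph, two paths joined by a random matching, is an expander: a set of vertices with few
  boundary edges is small or large. Partial assignments that violate no sum of a small set of
  equations then form a winning strategy for the adversary in the width game, since the sum
  of two small sets is small again as long as its boundary is. Following Ben-Sasson and Wigderson,
  such a strategy yields a size bound directly: greedily fix literals that the strategy leaves
  open so as to satisfy all clauses with many open literals, then follow
  falsified clauses upwards from the empty clause.
\<close>

section \<open>Winning positions and the length of refutations\<close>

text \<open>The size bound does not pass through a restricted formula, whose graph might no longer
  expand. Literals are fixed only inside the strategy; those whose value it already dictates count
  as forced and are left out of the position.

  Small vertex sets need not have a large boundary. What is required is a gap: no set with more than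
  \<open>s\<close> and at most \<open>2 * s\<close> vertices has a boundary of size at most
  \<open>K\<close>, where \<open>s\<close> and \<open>K\<close> are linear in \<open>n\<close>. This
  is why a position is tested against all sums of at most \<open>s\<close> equations and not against
  single equations only.

  The gap is likely because a set with a small boundary meets each path in few intervals and its two
  parts nearly correspond under \<open>\<sigma>\<close>. There are only 2^(cn) such configurations
  with a small c, whereas a random \<open>\<sigma>\<close> maps a given set of medium size onto
  another given set with probability at most about 2^(-n/4).\<close>

text \<open>
  Positions are partial assignments, encoded as the sets of literals they make true. The family
  \<open>H\<close> is a winning strategy of the adversary in the game of width \<open>K\<close> (Atserias and Dalmau).
\<close>
locale winning_positions =
  fixes F :: "'v cnf" and H :: "'v literal set set" and K :: nat
  assumes empty_position: "{} \<in> H"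
    and subset_position: "\<rho> \<in> H \<Longrightarrow> \<tau> \<subseteq> \<rho> \<Longrightarrow> \<tau> \<in> H"
    and extend_position:
      "\<rho> \<in> H \<Longrightarrow> finite \<rho> \<Longrightarrow> card \<rho> < K \<Longrightarrow> insert (Pos x) \<rho> \<in> H \<or> insert (Neg x) \<rho> \<in> H"
    and consistent_position: "\<rho> \<in> H \<Longrightarrow> Pos x \<in> \<rho> \<Longrightarrow> Neg x \<notin> \<rho>"
    and axiom_not_falsified: "C \<in> F \<Longrightarrow> \<rho> \<in> H \<Longrightarrow> \<not> neg_lit ` C \<subseteq> \<rho>"
begin

text \<open>
  A literal \<open>l\<close> is forced false by \<open>\<rho>\<close> if \<open>insert l \<rho> \<notin> H\<close>, so \<open>alive \<rho> C\<close>
  says that no literal of \<open>C\<close> is forced true.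
\<close>
definition alive :: "'v literal set \<Rightarrow> 'v clause \<Rightarrow> bool" where
  "alive \<rho> C \<longleftrightarrow> (\<forall>l\<in>C. insert (neg_lit l) \<rho> \<in> H)"

definition open_lits :: "'v literal set \<Rightarrow> 'v clause \<Rightarrow> 'v clause" where
  "open_lits \<rho> C = {l \<in> C. insert l \<rho> \<in> H}"

definition fat :: "nat \<Rightarrow> 'v clause set \<Rightarrow> 'v literal set \<Rightarrow> 'v clause set" where
  "fat w P \<rho> = {C \<in> P. alive \<rho> C \<and> w \<le> card (open_lits \<rho> C)}"

lemma extend_position_lit:
  assumes "\<rho> \<in> H" "finite \<rho>" "card \<rho> < K"
  shows "insert l \<rho> \<in> H \<or> insert (neg_lit l) \<rho> \<in> H"
  using extend_position[OF assms] by (cases l) auto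

text \<open>A literal forced false by \<open>\<rho>\<close> stays forced in every larger position,
  as \<open>H\<close> is closed under subsets; a query about it can only be answered
  negatively.\<close>

lemma extend_forced:
  assumes "finite D" "\<tau> \<in> H" "finite \<tau>" "\<rho> \<subseteq> \<tau>" "card \<tau> + card D \<le> K"
    and "\<And>l. l \<in> D \<Longrightarrow> insert l \<rho> \<notin> H"
  shows "\<tau> \<union> neg_lit ` D \<in> H"
  using assms
proof (induction D rule: finite_induct)
  case empty
  then show ?case by simp
next
  case (insert l D)
  have D: "\<tau> \<union> neg_lit ` D \<in> H" using insert by simp
  have "card (\<tau> \<union> neg_lit ` D) \<le> card \<tau> + card D"
    using card_Un_le[of \<tau> "neg_lit ` D"] card_image_le[OF insert.hyps(1), of neg_lit] by linarith
  also have "\<dots> < K" using insert by simp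
  finally have "insert l (\<tau> \<union> neg_lit ` D) \<in> H \<or> insert (neg_lit l) (\<tau> \<union> neg_lit ` D) \<in> H"
    using extend_position_lit[OF D] insert.prems insert.hyps by simp
  moreover have "insert l (\<tau> \<union> neg_lit ` D) \<notin> H"
    using subset_position[of _ "insert l \<rho>"] insert.prems(3,5) by blast
  ultimately show ?case by simp
qed

text \<open>If all alive clauses had fewer than \<open>w\<close> open literals, the adversary could
  walk from the empty clause to an axiom, moving at each step to the premise whose pivot literal is
  answered false. At the axiom the forced literals are falsified too, by
  \<open>extend_forced\<close>; the 3 in the bound pays for them.\<close>

lemma ex_fat_clause:
  assumes ref: "resolution_refutation F \<pi>"
    and fin: "\<And>C. C \<in> set \<pi> \<Longrightarrow> finite C"
    and width: "\<And>C. C \<in> F \<Longrightarrow> card C \<le> 3"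
    and \<rho>: "\<rho> \<in> H" "finite \<rho>" "card \<rho> + w + 3 \<le> K"
  shows "fat w (set \<pi>) \<rho> \<noteq> {}"
proof
  assume thin: "fat w (set \<pi>) \<rho> = {}"
  \<comment> \<open>Literals of \<open>C\<close> that are not open are forced false by
    \<open>\<rho>\<close>. Recording only the open ones keeps the position below \<open>K\<close>
    even if \<open>C\<close> is wide.\<close>
  define P where
    "P C \<longleftrightarrow> alive \<rho> C \<and> (\<exists>\<tau>\<in>H. \<rho> \<subseteq> \<tau> \<and> neg_lit ` open_lits \<rho> C \<subseteq> \<tau>)" for C
  have "\<not> P (\<pi> ! i)" if "i < length \<pi>" for i
    using that
  proof (induction i rule: less_induct)
    case (less i)
    define C where "C = \<pi> ! i"
    have C: "C \<in> set \<pi>" using less.prems C_def by simp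
    show ?case
    proof
      assume P: "P (\<pi> ! i)"
      then have alive: "alive \<rho> C" by (simp add: P_def C_def)
      define \<tau> where "\<tau> = \<rho> \<union> neg_lit ` open_lits \<rho> C"
      have "\<tau> \<in> H" using P subset_position unfolding P_def C_def \<tau>_def by (metis Un_least)
      have fin_open: "finite (open_lits \<rho> C)" using fin[OF C] by (simp add: open_lits_def)
      have fin_tau: "finite \<tau>" using \<rho> fin_open by (simp add: \<tau>_def)
      have "card (open_lits \<rho> C) < w" using thin C alive by (auto simp: fat_def)
      moreover have "card \<tau> \<le> card \<rho> + card (open_lits \<rho> C)"
        unfolding \<tau>_def using card_Un_le[of \<rho> "neg_lit ` open_lits \<rho> C"]
          card_image_le[OF fin_open, of neg_lit] by linarith
      ultimately have card_tau: "card \<tau> + 3 < K" using \<rho>(3) by linarith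
      consider "C \<in> F" | j k where "j < i" "k < i" "resolvent (\<pi> ! j) (\<pi> ! k) C"
        using ref less.prems unfolding resolution_refutation_def resolution_derivation_def C_def
        by blast
      then show False
      proof cases
        case 1
        have "card (C - open_lits \<rho> C) \<le> 3"
          using width[OF 1] card_mono[OF fin[OF C], of "C - open_lits \<rho> C"] by auto
        then have "\<tau> \<union> neg_lit ` (C - open_lits \<rho> C) \<in> H"
          using card_tau fin[OF C] \<open>\<tau> \<in> H\<close> fin_tau
          by (intro extend_forced[where \<rho> = \<rho>]) (auto simp: \<tau>_def open_lits_def)
        moreover have "neg_lit ` C \<subseteq> \<tau> \<union> neg_lit ` (C - open_lits \<rho> C)"
          by (auto simp: \<tau>_def)
        ultimately show False using axiom_not_falsified[OF 1] by blast
      next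
        case 2
        then obtain C1 C2 x where res: "\<pi> ! j = insert (Pos x) C1" "\<pi> ! k = insert (Neg x) C2"
          "C = C1 \<union> C2" unfolding resolvent_def by blast
        have step: "P (insert l D)" if "insert (neg_lit l) \<tau> \<in> H" "D \<subseteq> C" for l D
        proof -
          have "insert (neg_lit l) \<rho> \<in> H"
            by (rule subset_position[OF that(1)]) (auto simp: \<tau>_def)
          then have "alive \<rho> (insert l D)" using alive that(2) by (auto simp: alive_def)
          moreover have "neg_lit ` open_lits \<rho> (insert l D) \<subseteq> insert (neg_lit l) \<tau>"
            using that(2) by (auto simp: open_lits_def \<tau>_def)
          ultimately show ?thesis unfolding P_def using that(1)
            by (auto simp: \<tau>_def intro!: bexI[of _ "insert (neg_lit l) \<tau>"])
        qed
        have "insert (Pos x) \<tau> \<in> H \<or> insert (Neg x) \<tau> \<in> H"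
          using extend_position \<open>\<tau> \<in> H\<close> fin_tau card_tau by simp
        then have "P (\<pi> ! j) \<or> P (\<pi> ! k)"
          using step[of "Pos x" C1] step[of "Neg x" C2] res by auto
        then show False using less.IH 2 less.prems by auto
      qed
    qed
  qed
  moreover have "P (\<pi> ! (length \<pi> - 1))"
    using ref \<rho>(1) by (auto simp: resolution_refutation_def last_conv_nth P_def alive_def open_lits_def)
  ultimately show False using ref by (simp add: resolution_refutation_def)
qed

section \<open>Greedy restriction and the resulting size bound\<close>

text \<open>Each fat clause has at least \<open>w\<close> of the \<open>card L\<close> literals
  open, so some literal is open in a fraction \<open>w / card L\<close> of them. Fixing it removes
  these clauses. No other clause becomes fat, since being alive and having open literals can only be
  lost when the position grows.\<close>

lemma ex_restriction_few_fat:
  assumes "finite L" "L \<noteq> {}" "P \<subseteq> Pow L" "w \<le> card L"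
  shows "\<exists>\<rho>\<in>H. finite \<rho> \<and> card \<rho> \<le> i \<and>
    real (card (fat w P \<rho>)) \<le> (1 - real w / real (card L)) ^ i * real (card P)"
proof (induction i)
  case 0
  have "finite P" using assms(1,3) finite_subset by auto
  then have "card (fat w P {}) \<le> card P" by (intro card_mono) (auto simp: fat_def)
  then show ?case using empty_position by (intro bexI[of _ "{}"]) auto
next
  case (Suc i)
  then obtain \<rho> where \<rho>: "\<rho> \<in> H" "finite \<rho>" "card \<rho> \<le> i"
    and few: "real (card (fat w P \<rho>)) \<le> (1 - real w / real (card L)) ^ i * real (card P)" by blast
  define G where "G = fat w P \<rho>"
  define g where "g l = card {C \<in> G. l \<in> open_lits \<rho> C}" for l
  have GP: "G \<subseteq> P" by (auto simp: G_def fat_def)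
  have finG: "finite G" using assms(1,3) GP by (meson finite_Pow_iff finite_subset)
  have L0: "real (card L) > 0" using assms(1,2) by (simp add: card_gt_0_iff)
  have "real w * real (card G) = (\<Sum>C\<in>G. real w)" by simp
  also have "\<dots> \<le> (\<Sum>C\<in>G. real (card (open_lits \<rho> C)))"
    by (intro sum_mono) (auto simp: G_def fat_def)
  also have "\<dots> = (\<Sum>C\<in>G. \<Sum>l\<in>L. of_bool (l \<in> open_lits \<rho> C))"
  proof (intro sum.cong refl)
    fix C assume "C \<in> G"
    then have "open_lits \<rho> C \<subseteq> L" using GP assms(3) by (auto simp: open_lits_def)
    then have "{l \<in> L. l \<in> open_lits \<rho> C} = open_lits \<rho> C" by blast
    then show "real (card (open_lits \<rho> C)) = (\<Sum>l\<in>L. of_bool (l \<in> open_lits \<rho> C))"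
      using assms(1) by (simp add: sum.If_cases of_bool_def Int_def)
  qed
  also have "\<dots> = (\<Sum>l\<in>L. \<Sum>C\<in>G. of_bool (l \<in> open_lits \<rho> C))" by (rule sum.swap)
  also have "\<dots> = (\<Sum>l\<in>L. real (g l))"
    using finG by (simp add: g_def sum.If_cases of_bool_def Int_def)
  finally have avg: "real w * real (card G) \<le> (\<Sum>l\<in>L. real (g l))" .
  have "\<exists>l\<in>L. real w / real (card L) * real (card G) \<le> real (g l)"
  proof (rule ccontr)
    assume "\<not> ?thesis"
    then have "(\<Sum>l\<in>L. real (g l)) < (\<Sum>l\<in>L. real w / real (card L) * real (card G))"
      using assms(1,2) by (intro sum_strict_mono) auto
    then show False using avg L0 by simp
  qed
  then obtain l where l: "l \<in> L" "real w / real (card L) * real (card G) \<le> real (g l)" by blast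
  have shrink: "(1 - real w / real (card L)) * real (card G)
      \<le> (1 - real w / real (card L)) ^ Suc i * real (card P)"
    using few assms(4) L0 by (simp add: G_def mult.assoc mult_left_mono)
  show ?case
  \<comment> \<open>The average can select a literal that is not insertable only if it is 0; then
    \<open>\<rho>\<close> itself meets the next bound.\<close>
  proof (cases "insert l \<rho> \<in> H")
    case False
    then have "g l = 0" by (simp add: g_def open_lits_def)
    then have "real w / real (card L) * real (card G) \<le> 0" using l by simp
    then have "real (card G) \<le> (1 - real w / real (card L)) * real (card G)"
      by (simp add: algebra_simps)
    with shrink show ?thesis using \<rho> unfolding G_def by (intro bexI[of _ \<rho>]) auto
  next
    case True
    have "fat w P (insert l \<rho>) \<subseteq> G - {C \<in> G. l \<in> open_lits \<rho> C}"
    proof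
      fix C assume C: "C \<in> fat w P (insert l \<rho>)"
      have C': "C \<in> P" "w \<le> card (open_lits (insert l \<rho>) C)"
        and al: "\<And>m. m \<in> C \<Longrightarrow> insert (neg_lit m) (insert l \<rho>) \<in> H"
        using C by (auto simp: fat_def alive_def)
      have "finite C" using C'(1) assms(1,3) by (meson PowD finite_subset subsetD)
      moreover have "open_lits (insert l \<rho>) C \<subseteq> open_lits \<rho> C"
        unfolding open_lits_def using subset_position[of "insert m (insert l \<rho>)" "insert m \<rho>" for m]
        by blast
      ultimately have "w \<le> card (open_lits \<rho> C)"
        using C'(2) card_mono[of "open_lits \<rho> C" "open_lits (insert l \<rho>) C"]
        by (simp add: open_lits_def)
      moreover have "alive \<rho> C"
        unfolding alive_def
      proof
        fix m assume "m \<in> C"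
        show "insert (neg_lit m) \<rho> \<in> H"
          by (rule subset_position[OF al[OF \<open>m \<in> C\<close>]]) auto
      qed
      \<comment> \<open>A clause with the fixed literal is not alive: falsifying it would need a
        position containing both \<open>l\<close> and \<open>neg_lit l\<close>.\<close>
      moreover have "l \<notin> C"
      proof
        assume "l \<in> C"
        from al[OF this] show False using consistent_position by (cases l) force+
      qed
      ultimately show "C \<in> G - {C \<in> G. l \<in> open_lits \<rho> C}"
        using C'(1) by (auto simp: G_def fat_def open_lits_def)
    qed
    then have "card (fat w P (insert l \<rho>)) \<le> card (G - {C \<in> G. l \<in> open_lits \<rho> C})"
      using finG by (intro card_mono) auto
    also have "\<dots> = card G - g l" unfolding g_def using finG by (intro card_Diff_subset) auto
    finally have "real (card (fat w P (insert l \<rho>))) \<le> real (card G) - real (g l)"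
      using card_mono[OF finG, of "{C \<in> G. l \<in> open_lits \<rho> C}"] unfolding g_def by simp
    also have "\<dots> \<le> (1 - real w / real (card L)) * real (card G)"
      using l(2) by (simp add: algebra_simps)
    finally show ?thesis
      using shrink True \<rho> by (intro bexI[of _ "insert l \<rho>"]) (auto simp: card_insert_if)
  qed
qed

lemma derivation_lits:
  assumes "resolution_derivation F \<pi>" "F \<subseteq> Pow L"
  shows "set \<pi> \<subseteq> Pow L"
proof -
  have "\<pi> ! i \<subseteq> L" if "i < length \<pi>" for i
    using that
  proof (induction i rule: less_induct)
    case (less i)
    then consider "\<pi> ! i \<in> F" | j k where "j < i" "k < i" "resolvent (\<pi> ! j) (\<pi> ! k) (\<pi> ! i)"
      using assms(1) unfolding resolution_derivation_def by blast
    then show ?case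
    proof cases
      case 1
      then show ?thesis using assms(2) by blast
    next
      case 2
      then have "\<pi> ! j \<subseteq> L" "\<pi> ! k \<subseteq> L" using less by auto
      then show ?thesis using 2(3) by (auto simp: resolvent_def)
    qed
  qed
  then show ?thesis by (metis PowI in_set_conv_nth subsetI)
qed

text \<open>At least one fat clause survives a restriction by \<open>k\<close> literals, but the
  greedy one leaves at most \<open>(1 - w / card L) ^ k * length \<pi>\<close> of them. The budget
  \<open>K\<close> covers \<open>k\<close> literals of the restriction, \<open>w\<close> open ones
  and 3 of an axiom.\<close>

theorem refutation_length_ge:
  assumes ref: "resolution_refutation F \<pi>"
    and L: "finite L" "L \<noteq> {}" "F \<subseteq> Pow L" "w \<le> card L"
    and width: "\<And>C. C \<in> F \<Longrightarrow> card C \<le> 3"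
    and K: "k + w + 3 \<le> K"
  shows "exp (real k * real w / real (card L)) \<le> real (length \<pi>)"
proof -
  have P: "set \<pi> \<subseteq> Pow L"
    using derivation_lits ref L(3) unfolding resolution_refutation_def by blast
  obtain \<rho> where \<rho>: "\<rho> \<in> H" "finite \<rho>" "card \<rho> \<le> k"
    and few: "real (card (fat w (set \<pi>) \<rho>)) \<le>
      (1 - real w / real (card L)) ^ k * real (card (set \<pi>))"
    using ex_restriction_few_fat[OF L(1,2) P L(4), of k] by blast
  have fin: "finite C" if "C \<in> set \<pi>" for C
    using that P L(1) by (meson PowD finite_subset subsetD)
  have "fat w (set \<pi>) \<rho> \<noteq> {}"
    using ex_fat_clause[OF ref fin width \<rho>(1,2), of w] \<rho>(3) K by simp
  moreover have "finite (fat w (set \<pi>) \<rho>)" by (simp add: fat_def)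
  ultimately have "1 \<le> real (card (fat w (set \<pi>) \<rho>))"
    by (simp add: Suc_le_eq card_gt_0_iff)
  also note few
  also have "(1 - real w / real (card L)) ^ k * real (card (set \<pi>)) \<le>
      exp (- (real w / real (card L))) ^ k * real (length \<pi>)"
  proof (intro mult_mono power_mono)
    show "1 - real w / real (card L) \<le> exp (- (real w / real (card L)))"
      using exp_ge_add_one_self[of "- (real w / real (card L))"] by simp
    show "0 \<le> 1 - real w / real (card L)" using L(4) by (cases "card L = 0") auto
  qed (auto simp: card_length)
  also have "exp (- (real w / real (card L))) ^ k = exp (- (real k * real w / real (card L)))"
    by (simp flip: exp_of_nat_mult)
  finally show ?thesis by (simp add: exp_minus field_simps)
qed

end

section \<open>Linear systems over GF(2) with expanding boundary\<close>

fun atm :: "'v literal \<Rightarrow> 'v" where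
  "atm (Pos v) = v"
| "atm (Neg v) = v"

section \<open>Boundaries as sums over GF(2)\<close>

lemma even_card_sym_diff:
  assumes "finite A" "finite B"
  shows "even (card (sym_diff A B)) \<longleftrightarrow> (even (card A) \<longleftrightarrow> even (card B))"
proof -
  have "card A = card (A - B) + card (A \<inter> B)" "card B = card (B - A) + card (A \<inter> B)"
    using assms card_Diff_subset_Int[of A B] card_Diff_subset_Int[of B A]
      card_mono[of A "A \<inter> B"] card_mono[of B "A \<inter> B"] by (auto simp: Int_commute)
  moreover have "card (sym_diff A B) = card (A - B) + card (B - A)"
    using assms by (intro card_Un_disjoint) auto
  ultimately show ?thesis by presburger
qed

definition boundary :: "('n \<Rightarrow> 'v set) \<Rightarrow> 'n set \<Rightarrow> 'v set" where
  "boundary E U = {e. odd (card {v \<in> U. e \<in> E v})}"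

lemma boundary_sym_diff:
  assumes "finite U" "finite W"
  shows "boundary E (sym_diff U W) = sym_diff (boundary E U) (boundary E W)"
proof -
  have "{v \<in> sym_diff U W. e \<in> E v} = sym_diff {v \<in> U. e \<in> E v} {v \<in> W. e \<in> E v}" for e
    by auto
  then show ?thesis using assms by (auto simp: boundary_def even_card_sym_diff)
qed

lemma boundary_singleton: "boundary E {v} = E v"
proof -
  have "{u \<in> {v}. e \<in> E u} = (if e \<in> E v then {v} else {})" for e by auto
  then show ?thesis by (auto simp: boundary_def)
qed

text \<open>
  \<open>V\<close> indexes equations over GF(2), with variables \<open>E v\<close> and right-hand side 1 exactly
  for \<open>v \<in> Q\<close>; the sum of the equations in \<open>U\<close> has the variables \<open>boundary E U\<close>.
\<close>
locale expanding_system =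
  fixes V :: "'n set" and E :: "'n \<Rightarrow> 'v set" and Q :: "'n set" and s K :: nat
  assumes finite_V: "finite V"
    and s_pos: "1 \<le> s"
    and expanding: "U \<subseteq> V \<Longrightarrow> finite (boundary E U) \<Longrightarrow> card (boundary E U) \<le> K \<Longrightarrow>
      card U \<le> s \<or> 2 * s < card U"
    and small_boundary_nonempty: "U \<subseteq> V \<Longrightarrow> card U \<le> s \<Longrightarrow> boundary E U = {} \<Longrightarrow> U = {}"
begin

text \<open>Meaningful only if \<open>\<rho>\<close> assigns all of \<open>boundary E U\<close>,
  since unassigned variables count as false; \<open>positions\<close> asks for it only then.\<close>

definition obeys :: "'v literal set \<Rightarrow> 'n set \<Rightarrow> bool" where
  "obeys \<rho> U \<longleftrightarrow> even (card {e \<in> boundary E U. Pos e \<in> \<rho>} + card (U \<inter> Q))"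

definition positions :: "'v literal set set" where
  "positions = {\<rho>. finite \<rho> \<and> card \<rho> \<le> K \<and> (\<forall>x. Pos x \<in> \<rho> \<longrightarrow> Neg x \<notin> \<rho>) \<and>
     (\<forall>U\<subseteq>V. card U \<le> s \<longrightarrow> boundary E U \<subseteq> atm ` \<rho> \<longrightarrow> obeys \<rho> U)}"

lemma subset_positions:
  assumes "\<rho> \<in> positions" "\<tau> \<subseteq> \<rho>"
  shows "\<tau> \<in> positions"
proof -
  have \<rho>: "finite \<rho>" "card \<rho> \<le> K" "\<And>x. Pos x \<in> \<rho> \<Longrightarrow> Neg x \<notin> \<rho>"
    "\<And>U. U \<subseteq> V \<Longrightarrow> card U \<le> s \<Longrightarrow> boundary E U \<subseteq> atm ` \<rho> \<Longrightarrow> obeys \<rho> U"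
    using assms(1) by (auto simp: positions_def)
  have "obeys \<tau> U" if U: "U \<subseteq> V" "card U \<le> s" "boundary E U \<subseteq> atm ` \<tau>" for U
  proof -
    have "Pos e \<in> \<tau> \<longleftrightarrow> Pos e \<in> \<rho>" if "e \<in> atm ` \<tau>" for e
    proof -
      have "Pos e \<in> \<tau> \<or> Neg e \<in> \<tau>" using that by (metis atm.elims imageE)
      then show ?thesis using \<rho>(3)[of e] assms(2) by blast
    qed
    then have "{e \<in> boundary E U. Pos e \<in> \<tau>} = {e \<in> boundary E U. Pos e \<in> \<rho>}"
      using U(3) by blast
    moreover have "boundary E U \<subseteq> atm ` \<rho>" using U(3) assms(2) by blast
    ultimately show ?thesis using \<rho>(4)[OF U(1,2)] by (simp add: obeys_def)
  qed
  moreover have "card \<tau> \<le> K" using card_mono[OF \<rho>(1) assms(2)] \<rho>(2) by simp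
  ultimately show ?thesis
    using \<rho>(1,3) assms(2) finite_subset unfolding positions_def by blast
qed

text \<open>
  If neither value of \<open>x\<close> is admissible, two small sets force opposite values. Their symmetric
  difference is small by expansion, and its equation no longer mentions \<open>x\<close> but contradicts \<open>\<rho>\<close>.
\<close>
lemma extend_positions:
  assumes "\<rho> \<in> positions" "card \<rho> < K"
  shows "insert (Pos x) \<rho> \<in> positions \<or> insert (Neg x) \<rho> \<in> positions"
proof (cases "x \<in> atm ` \<rho>")
  case True
  then have "Pos x \<in> \<rho> \<or> Neg x \<in> \<rho>" by (metis atm.elims imageE)
  then show ?thesis using assms(1) by (auto simp: insert_absorb)
next
  case False
  have \<rho>: "finite \<rho>" "\<And>x. Pos x \<in> \<rho> \<Longrightarrow> Neg x \<notin> \<rho>"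
    "\<And>U. U \<subseteq> V \<Longrightarrow> card U \<le> s \<Longrightarrow> boundary E U \<subseteq> atm ` \<rho> \<Longrightarrow> obeys \<rho> U"
    using assms(1) by (auto simp: positions_def)
  have new: "Pos x \<notin> \<rho>" "Neg x \<notin> \<rho>"
    using False image_iff by fastforce+
  have violated: "\<exists>U\<subseteq>V. card U \<le> s \<and> x \<in> boundary E U \<and>
      boundary E U \<subseteq> insert x (atm ` \<rho>) \<and> \<not> obeys (insert l \<rho>) U"
    if l: "atm l = x" "insert l \<rho> \<notin> positions" for l
  proof -
    have "card (insert l \<rho>) \<le> K" using assms(2) \<rho>(1) by (simp add: card_insert_if)
    moreover have "\<forall>y. Pos y \<in> insert l \<rho> \<longrightarrow> Neg y \<notin> insert l \<rho>"
      using \<rho>(2) new l(1) by (cases l) auto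
    ultimately obtain U where U: "U \<subseteq> V" "card U \<le> s" "boundary E U \<subseteq> insert x (atm ` \<rho>)"
        "\<not> obeys (insert l \<rho>) U"
      using l \<rho>(1) unfolding positions_def by auto
    have "x \<in> boundary E U"
    proof (rule ccontr)
      assume x: "x \<notin> boundary E U"
      then have "{e \<in> boundary E U. Pos e \<in> insert l \<rho>} = {e \<in> boundary E U. Pos e \<in> \<rho>}"
        using l(1) by auto
      then show False using \<rho>(3)[OF U(1,2)] U(3,4) x by (auto simp: obeys_def)
    qed
    with U show ?thesis by blast
  qed
  show ?thesis
  proof (rule ccontr)
    assume neither: "\<not> ?thesis"
    obtain U where U: "U \<subseteq> V" "card U \<le> s" "x \<in> boundary E U"
      "boundary E U \<subseteq> insert x (atm ` \<rho>)" "\<not> obeys (insert (Pos x) \<rho>) U"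
      using violated[of "Pos x"] neither by auto
    obtain W where W: "W \<subseteq> V" "card W \<le> s" "x \<in> boundary E W"
      "boundary E W \<subseteq> insert x (atm ` \<rho>)" "\<not> obeys (insert (Neg x) \<rho>) W"
      using violated[of "Neg x"] neither by auto
    have fin: "finite U" "finite W" "finite (boundary E U)" "finite (boundary E W)"
      using U W finite_V \<rho>(1) by (auto intro: finite_subset)
    define T where "T = sym_diff U W"
    have T: "T \<subseteq> V" "boundary E T = sym_diff (boundary E U) (boundary E W)"
      using U(1) W(1) boundary_sym_diff[OF fin(1,2), of E] by (auto simp only: T_def)
    have sub: "boundary E T \<subseteq> atm ` \<rho>" unfolding T(2) using U(3,4) W(3,4) by blast
    have "card (boundary E T) \<le> K"
      using card_mono[OF _ sub] card_image_le[OF \<rho>(1), of atm] \<rho>(1) assms(2) by simp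
    then have "card T \<le> s \<or> 2 * s < card T"
      using expanding[OF T(1)] fin T(2) by simp
    moreover have "card T \<le> 2 * s"
      using card_Un_le[of "U - W" "W - U"] card_mono[OF fin(1), of "U - W"]
        card_mono[OF fin(2), of "W - U"] U(2) W(2) unfolding T_def by auto
    ultimately have "card T \<le> s" by linarith
    then have obeys_T: "obeys \<rho> T" by (rule \<rho>(3)[OF T(1) _ sub])
    define u where "u = {e \<in> boundary E U. Pos e \<in> \<rho>}"
    define w where "w = {e \<in> boundary E W. Pos e \<in> \<rho>}"
    have fuw: "finite u" "finite w" using fin by (auto simp: u_def w_def)
    have "{e \<in> boundary E U. Pos e \<in> insert (Pos x) \<rho>} = insert x u" "x \<notin> u"
      using U(3) new by (auto simp: u_def)
    then have odd_u: "odd (Suc (card u) + card (U \<inter> Q))"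
      using U(5) fuw by (simp add: obeys_def)
    have "{e \<in> boundary E W. Pos e \<in> insert (Neg x) \<rho>} = w" by (auto simp: w_def)
    then have odd_w: "odd (card w + card (W \<inter> Q))"
      using W(5) by (simp add: obeys_def)
    have "{e \<in> boundary E T. Pos e \<in> \<rho>} = sym_diff u w" "T \<inter> Q = sym_diff (U \<inter> Q) (W \<inter> Q)"
      unfolding T(2) by (auto simp: u_def w_def T_def)
    then show False
      using obeys_T odd_u odd_w even_card_sym_diff[OF fuw]
        even_card_sym_diff[of "U \<inter> Q" "W \<inter> Q"] fin by (auto simp: obeys_def)
  qed
qed

text \<open>Falsifying a clause of equation \<open>v\<close> assigns all variables of
  \<open>v\<close> and violates it, and \<open>1 \<le> s\<close> puts \<open>U = {v}\<close> among
  the sums respected by positions. The empty position is admissible because no nonempty small sum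
  loses all its variables.\<close>

lemma winning_positions:
  assumes "\<And>C. C \<in> F \<Longrightarrow> \<exists>v\<in>V. \<exists>ys. C \<in> xor_cnf ys \<and> distinct (map atm ys) \<and>
      atm ` set ys = E v \<and> (odd (length (filter (\<lambda>l. l \<in> range Neg) ys)) \<longleftrightarrow> v \<in> Q)"
  shows "winning_positions F positions K"
proof
  show "{} \<in> positions"
  proof -
    have "obeys {} U" if "U \<subseteq> V" "card U \<le> s" "boundary E U \<subseteq> {}" for U
      using small_boundary_nonempty[OF that(1,2)] that(3) by (simp add: obeys_def)
    then show ?thesis by (simp add: positions_def)
  qed
  show "\<tau> \<in> positions" if "\<rho> \<in> positions" "\<tau> \<subseteq> \<rho>" for \<rho> \<tau>
    using that by (rule subset_positions)
  show "insert (Pos x) \<rho> \<in> positions \<or> insert (Neg x) \<rho> \<in> positions"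
    if "\<rho> \<in> positions" "card \<rho> < K" for \<rho> x
    using that by (rule extend_positions)
  show "Neg x \<notin> \<rho>" if "\<rho> \<in> positions" "Pos x \<in> \<rho>" for \<rho> x
    using that by (auto simp: positions_def)
  show "\<not> neg_lit ` C \<subseteq> \<rho>" if "C \<in> F" "\<rho> \<in> positions" for C \<rho>
  proof
    assume C: "neg_lit ` C \<subseteq> \<rho>"
    obtain v ys where ys: "v \<in> V" "C \<in> xor_cnf ys" "distinct (map atm ys)" "atm ` set ys = E v"
      "odd (length (filter (\<lambda>l. l \<in> range Neg) ys)) \<longleftrightarrow> v \<in> Q"
      using assms[OF \<open>C \<in> F\<close>] by blast
    define a where "a x \<longleftrightarrow> Pos x \<in> \<rho>" for x
    have cons: "Neg x \<notin> \<rho>" if "Pos x \<in> \<rho>" for x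
      using that \<open>\<rho> \<in> positions\<close> by (auto simp: positions_def)
    have "\<not> lit_true a l" if "l \<in> C" for l
    proof -
      have "neg_lit l \<in> \<rho>" using that C by blast
      then show ?thesis using cons by (cases l) (auto simp: a_def)
    qed
    then have "\<not> satisfies a (xor_cnf ys)" using ys(2) by (auto simp: satisfies_def)
    then have odd: "odd (\<Sum>y\<leftarrow>ys. of_bool (lit_true a y) :: nat)"
      by (simp add: satisfies_xor_cnf)
    \<comment> \<open>Each negation flips the contribution of its literal, so the negations account
      for the difference in parity between true literals and true variables. Distinct atoms prevent
      double counting.\<close>
    have "even ((\<Sum>y\<leftarrow>ys. of_bool (lit_true a y) :: nat) + card {e \<in> atm ` set ys. a e} +
        length (filter (\<lambda>l. l \<in> range Neg) ys))"
      using ys(3)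
    proof (induction ys)
      case Nil
      then show ?case by simp
    next
      case (Cons y ys)
      define M where "M = {e \<in> atm ` set ys. a e}"
      have "{e \<in> atm ` set (y # ys). a e} = (if a (atm y) then insert (atm y) M else M)"
        by (auto simp: M_def)
      moreover have "finite M" "atm y \<notin> M" using Cons.prems by (auto simp: M_def)
      ultimately have "card {e \<in> atm ` set (y # ys). a e} = of_bool (a (atm y)) + card M"
        by (simp only: card_insert_disjoint of_bool_def split: if_split) simp
      then have "card {e \<in> atm ` set (y # ys). a e} =
          of_bool (a (atm y)) + card {e \<in> atm ` set ys. a e}" by (simp only: M_def)
      then show ?case using Cons by (cases y) (auto simp del: set_simps)
    qed
    then have "odd (card {e \<in> E v. a e} + of_bool (v \<in> Q))" using odd ys(4,5) by auto
    moreover have "card ({v} \<inter> Q) = of_bool (v \<in> Q)" by auto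
    ultimately have "\<not> obeys \<rho> {v}" by (simp add: obeys_def boundary_singleton a_def)
    moreover have "E v \<subseteq> atm ` \<rho>"
    proof
      fix e assume "e \<in> E v"
      then obtain y where y: "y \<in> set ys" "e = atm y" using ys(4) by auto
      obtain bs where bs: "C = signed bs ys" "length bs = length ys"
        using ys(2) by (auto simp: xor_cnf_def)
      obtain i where i: "i < length ys" "ys ! i = y" using y(1) by (auto simp: in_set_conv_nth)
      have "(if bs ! i then neg_lit y else y) \<in> C"
        unfolding bs(1) signed_def using i bs(2)
        by (auto simp: set_conv_nth intro!: exI[of _ i])
      then have "neg_lit (if bs ! i then neg_lit y else y) \<in> \<rho>" using C by blast
      moreover have "atm (neg_lit l) = atm l" for l :: "'v literal" by (cases l) auto
      ultimately show "e \<in> atm ` \<rho>" using y(2) by (metis imageI neg_lit_neg_lit)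
    qed
    ultimately show False
      using \<open>\<rho> \<in> positions\<close> ys(1) s_pos by (auto simp: positions_def boundary_singleton)
  qed
qed

end

section \<open>Counting permutations\<close>

text \<open>If any such permutation \<open>\<sigma>0\<close> exists, all of them lie in its coset
  modulo the stabilizer of \<open>Y\<close>, which is the product of the symmetric groups on
  \<open>Y\<close> and \<open>S - Y\<close>.\<close>

lemma card_permutes_image_le:
  assumes "finite S" "Y \<subseteq> S"
  shows "card {\<sigma>. \<sigma> permutes S \<and> \<sigma> ` Y = Z} \<le> fact (card Y) * fact (card S - card Y)"
proof (cases "{\<sigma>. \<sigma> permutes S \<and> \<sigma> ` Y = Z} = {}")
  case True
  then show ?thesis by (simp only: card.empty)
next
  case False
  then obtain \<sigma>0 where \<sigma>0: "\<sigma>0 permutes S" "\<sigma>0 ` Y = Z" by blast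
  have fin: "finite Y" "finite (S - Y)" using assms finite_subset by auto
  define f where "f = (\<lambda>(p, q). \<sigma>0 \<circ> ((p :: 'a \<Rightarrow> 'a) \<circ> (q :: 'a \<Rightarrow> 'a)))"
  have "{\<sigma>. \<sigma> permutes S \<and> \<sigma> ` Y = Z} \<subseteq> f ` ({p. p permutes Y} \<times> {q. q permutes (S - Y)})"
  proof
    fix \<sigma> assume "\<sigma> \<in> {\<sigma>. \<sigma> permutes S \<and> \<sigma> ` Y = Z}"
    then have \<sigma>: "\<sigma> permutes S" "\<sigma> ` Y = Z" by auto
    define \<tau> where "\<tau> = inv \<sigma>0 \<circ> \<sigma>"
    have \<tau>: "\<tau> permutes S" using \<sigma>(1) \<sigma>0(1) by (simp add: \<tau>_def permutes_compose permutes_inv)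
    have inj: "inj \<tau>" using \<tau> by (rule permutes_inj)
    have "\<tau> ` Y = inv \<sigma>0 ` \<sigma>0 ` Y" using \<sigma>(2) \<sigma>0(2) by (metis \<tau>_def image_comp)
    then have \<tau>Y: "\<tau> ` Y = Y" using \<sigma>0(1) by (simp add: image_comp permutes_inv_o)
    have \<tau>SY: "\<tau> ` (S - Y) = S - Y"
      using \<tau>Y permutes_image[OF \<tau>] inj by (simp add: image_set_diff)
    define p where "p x = (if x \<in> Y then \<tau> x else x)" for x
    define q where "q x = (if x \<in> S - Y then \<tau> x else x)" for x
    have p: "p permutes Y"
    proof (rule bij_imp_permutes)
      show "bij_betw p Y Y" using \<tau>Y inj_on_subset[OF inj]
        by (auto simp: bij_betw_def p_def inj_on_def cong: image_cong)
    qed (simp add: p_def)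
    have q: "q permutes (S - Y)"
    proof (rule bij_imp_permutes)
      have "q ` (S - Y) = \<tau> ` (S - Y)" by (rule image_cong) (auto simp: q_def)
      then show "bij_betw q (S - Y) (S - Y)" using \<tau>SY inj
        by (auto simp: bij_betw_def q_def inj_on_def)
    qed (auto simp: q_def)
    have "p \<circ> q = \<tau>"
    proof
      fix x
      show "(p \<circ> q) x = \<tau> x"
        using \<tau>SY permutes_not_in[OF \<tau>, of x] by (auto simp: p_def q_def)
    qed
    then have "f (p, q) = \<sigma>"
      using permutes_inverses(1)[OF \<sigma>0(1)] by (simp add: f_def \<tau>_def fun_eq_iff)
    then show "\<sigma> \<in> f ` ({p. p permutes Y} \<times> {q. q permutes (S - Y)})"
      using p q by (metis (mono_tags) SigmaI imageI mem_Collect_eq)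
  qed
  then have "card {\<sigma>. \<sigma> permutes S \<and> \<sigma> ` Y = Z} \<le>
      card ({p. p permutes Y} \<times> {q. q permutes (S - Y)})"
    using fin by (intro surj_card_le) (auto simp: finite_permutations)
  also have "\<dots> = fact (card Y) * fact (card (S - Y))"
    using fin by (simp add: card_cartesian_product card_permutations)
  also have "card (S - Y) = card S - card Y" using assms fin by (simp add: card_Diff_subset)
  finally show ?thesis .
qed

text \<open>Below the middle, \<open>n choose c\<close> is at least (n/c)^c and hence 2^c; above it,
  symmetry applies.\<close>

lemma two_power_le_binomial:
  assumes "k \<le> b" "b + k \<le> n"
  shows "2 ^ k \<le> (n choose b)"
proof -
  have half: "2 ^ k \<le> (n choose c)" if "k \<le> c" "2 * c \<le> n" for c
  proof (cases "c = 0")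
    case False
    have "(2 :: real) ^ k \<le> 2 ^ c" using that(1) by (intro power_increasing) auto
    also have "\<dots> \<le> (real n / real c) ^ c"
      using that(2) False by (intro power_mono) (auto simp: field_simps)
    also have "\<dots> \<le> real (n choose c)"
      using that(2) by (intro binomial_ge_n_over_k_pow_k) simp
    finally have "real (2 ^ k) \<le> real (n choose c)" by simp
    then show ?thesis by (simp only: of_nat_le_iff)
  qed (use that in simp)
  show ?thesis
  proof (cases "2 * b \<le> n")
    case True
    then show ?thesis using half assms by simp
  next
    case False
    then have "2 ^ k \<le> (n choose (n - b))" using assms by (intro half) auto
    then show ?thesis using binomial_symmetric[of b n] assms by simp
  qed
qed

lemma fact_mult_fact_le:
  assumes "k \<le> b" "b + k \<le> n"
  shows "2 ^ k * (fact b * fact (n - b)) \<le> (fact n :: nat)"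
proof -
  have "2 ^ k * (fact b * fact (n - b)) \<le> (n choose b) * (fact b * fact (n - b))"
    using two_power_le_binomial[OF assms] by (rule mult_right_mono) simp
  also have "\<dots> = fact n"
    using binomial_fact_lemma[of b n] assms by (simp add: mult_ac)
  finally show ?thesis .
qed

text \<open>Give \<open>D\<close> the weight \<open>64 ^ m / 64 ^ card D\<close>, which is at least
  1 on the counted sets, and sum over all subsets by the binomial theorem. The base 64 makes
  \<open>65 / 64\<close> close to 1 and is a power of 2.\<close>

lemma card_small_subsets_le:
  "real (card {D. D \<subseteq> {1..n} \<and> card D \<le> m}) \<le> 64 ^ m * (65 / 64) ^ n"
proof -
  have "real (card {D. D \<subseteq> {1..n} \<and> card D \<le> m}) = (\<Sum>D | D \<subseteq> {1..n} \<and> card D \<le> m. 1)"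
    by simp
  also have "\<dots> \<le> (\<Sum>D | D \<subseteq> {1..n} \<and> card D \<le> m. 64 ^ m * (1 / 64) ^ card D)"
  proof (intro sum_mono)
    fix D assume "D \<in> {D. D \<subseteq> {1..n} \<and> card D \<le> m}"
    then have "(64 :: real) ^ card D \<le> 64 ^ m" by (intro power_increasing) auto
    then show "1 \<le> 64 ^ m * (1 / 64 :: real) ^ card D" by (simp add: power_divide)
  qed
  also have "\<dots> \<le> (\<Sum>D\<in>Pow {1..n}. 64 ^ m * (1 / 64) ^ card D)"
    by (intro sum_mono2) auto
  also have "\<dots> = 64 ^ m * (\<Sum>D\<in>Pow {1..n}. \<Prod>i\<in>D. 1 / 64)"
    by (simp add: sum_distrib_left)
  also have "(\<Sum>D\<in>Pow {1..n}. \<Prod>i\<in>D. 1 / 64 :: real) = (\<Prod>i\<in>{1..n}. 1 + 1 / 64)"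
    using prod_add[of "{1..n}" "\<lambda>_. 1 / 64 :: real" "\<lambda>_. 1"] by (simp add: add.commute)
  finally show ?thesis by simp
qed

section \<open>Permutations that nearly match sets with few jumps\<close>

text \<open>Since 0 belongs to no subset of \<open>{1..n}\<close>, position 1 is a jump exactly when
  it is in the set. The jumps thus determine the set, read from the left.\<close>

definition jumps :: "nat \<Rightarrow> nat set \<Rightarrow> nat set" where
  "jumps n X = {p \<in> {1..n}. (p \<in> X) \<noteq> (p - 1 \<in> X)}"

lemma inj_on_jumps: "inj_on (jumps n) (Pow {1..n})"
proof (rule inj_onI)
  fix X Y assume XY: "X \<in> Pow {1..n}" "Y \<in> Pow {1..n}" and eq: "jumps n X = jumps n Y"
  have "p \<le> n \<Longrightarrow> p \<in> X \<longleftrightarrow> p \<in> Y" for p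
  proof (induction p)
    case 0
    then show ?case using XY by auto
  next
    case (Suc p)
    have "Suc p \<in> jumps n X \<longleftrightarrow> Suc p \<in> jumps n Y" using eq by simp
    then show ?case using Suc by (auto simp: jumps_def)
  qed
  then show "X = Y" using XY by auto
qed

text \<open>
  The permutations for which the graph may fail to expand: \<open>X\<close> and \<open>Y\<close> are the positions
  covered by a vertex set in the two chains, their jumps correspond to the boundary edges on the
  two paths, and the symmetric difference to those of the matching.
\<close>
definition bad_permutations :: "nat \<Rightarrow> nat \<Rightarrow> nat \<Rightarrow> (nat \<Rightarrow> nat) set" where
  "bad_permutations n m k = {\<sigma>. \<sigma> permutes {1..n} \<and> (\<exists>X\<subseteq>{1..n}. \<exists>Y\<subseteq>{1..n}.
      card (jumps n X) \<le> m \<and> card (jumps n Y) \<le> m \<and> card (sym_diff X (\<sigma> ` Y)) \<le> m \<and>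
      k \<le> card Y \<and> card Y + k \<le> n)}"

text \<open>
  Union bound over the triples of small sets formed by the jumps of \<open>X\<close>, the jumps of \<open>Y\<close> and
  the symmetric difference: such a triple determines \<open>Y\<close> and its image.
\<close>
lemma card_bad_permutations:
  "real (card (bad_permutations n m k)) \<le> (64 ^ m * (65 / 64) ^ n) ^ 3 * (fact n / 2 ^ k)"
proof -
  define \<D> where "\<D> = {D. D \<subseteq> {1..n} \<and> card D \<le> m}"
  define X where "X = the_inv_into (Pow {1..n}) (jumps n)"
  have X: "X (jumps n A) = A" if "A \<subseteq> {1..n}" for A
    unfolding X_def using that by (intro the_inv_into_f_f[OF inj_on_jumps]) simp
  define B where "B = (\<lambda>(D1, D2, D3). {\<sigma>. \<sigma> permutes {1..n} \<and> \<sigma> ` X D2 = sym_diff (X D1) D3 \<and>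
    X D2 \<subseteq> {1..n} \<and> k \<le> card (X D2) \<and> card (X D2) + k \<le> n})"
  have fin_D: "finite \<D>" by (simp add: \<D>_def)
  have "bad_permutations n m k \<subseteq> (\<Union>t\<in>\<D> \<times> \<D> \<times> \<D>. B t)"
  proof
    fix \<sigma> assume "\<sigma> \<in> bad_permutations n m k"
    then obtain A Y where \<sigma>: "\<sigma> permutes {1..n}" and AY: "A \<subseteq> {1..n}" "Y \<subseteq> {1..n}"
      "card (jumps n A) \<le> m" "card (jumps n Y) \<le> m" "card (sym_diff A (\<sigma> ` Y)) \<le> m"
      "k \<le> card Y" "card Y + k \<le> n" unfolding bad_permutations_def by blast
    have "\<sigma> ` Y \<subseteq> {1..n}" using permutes_image[OF \<sigma>] AY(2) by blast
    then have "(jumps n A, jumps n Y, sym_diff A (\<sigma> ` Y)) \<in> \<D> \<times> \<D> \<times> \<D>"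
      using AY by (auto simp: \<D>_def jumps_def)
    moreover have "\<sigma> \<in> B (jumps n A, jumps n Y, sym_diff A (\<sigma> ` Y))"
      using \<sigma> AY by (auto simp: B_def X)
    ultimately show "\<sigma> \<in> (\<Union>t\<in>\<D> \<times> \<D> \<times> \<D>. B t)" by blast
  qed
  moreover have fin_B: "finite (B t)" for t
    by (rule finite_subset[OF _ finite_permutations[of "{1..n}"]]) (auto simp: B_def split: prod.splits)
  ultimately have "card (bad_permutations n m k) \<le> card (\<Union>t\<in>\<D> \<times> \<D> \<times> \<D>. B t)"
    using fin_D by (intro card_mono) auto
  also have "\<dots> \<le> (\<Sum>t\<in>\<D> \<times> \<D> \<times> \<D>. card (B t))"
    using fin_D by (intro card_UN_le) auto
  finally have "real (card (bad_permutations n m k)) \<le> (\<Sum>t\<in>\<D> \<times> \<D> \<times> \<D>. real (card (B t)))"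
    by (simp flip: of_nat_sum)
  also have "\<dots> \<le> (\<Sum>t\<in>\<D> \<times> \<D> \<times> \<D>. fact n / 2 ^ k)"
  proof (rule sum_mono)
    fix t :: "nat set \<times> nat set \<times> nat set"
    obtain D1 D2 D3 where t: "t = (D1, D2, D3)" by (cases t)
    show "real (card (B t)) \<le> fact n / 2 ^ k"
    proof (cases "X D2 \<subseteq> {1..n} \<and> k \<le> card (X D2) \<and> card (X D2) + k \<le> n")
      case True
      have "card (B t) \<le> card {\<sigma>. \<sigma> permutes {1..n} \<and> \<sigma> ` X D2 = sym_diff (X D1) D3}"
        using finite_permutations[of "{1..n}"] by (intro card_mono) (auto simp: B_def t)
      also have "\<dots> \<le> fact (card (X D2)) * fact (n - card (X D2))"
        using card_permutes_image_le[of "{1..n}" "X D2"] True by simp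
      finally have "2 ^ k * card (B t) \<le> fact n"
        using fact_mult_fact_le[of k "card (X D2)" n] True by (meson le_trans mult_le_mono2)
      then have "real (2 ^ k * card (B t)) \<le> real (fact n)" by (simp only: of_nat_le_iff)
      then show ?thesis by (simp add: field_simps)
    next
      case False
      then have "B t = {}" by (auto simp: B_def t)
      then show ?thesis by simp
    qed
  qed
  also have "\<dots> = real (card \<D>) ^ 3 * (fact n / 2 ^ k)"
    by (simp add: card_cartesian_product power3_eq_cube)
  also have "\<dots> \<le> (64 ^ m * (65 / 64) ^ n) ^ 3 * (fact n / 2 ^ k)"
    using card_small_subsets_le[of n m] by (intro mult_right_mono power_mono) (auto simp: \<D>_def)
  finally show ?thesis .
qed

section \<open>The reordered parity formula as a linear system\<close>

text \<open>A chain of \<open>n\<close> literals has \<open>n - 2\<close> equations. Equation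
  \<open>j\<close> contains the links \<open>j - 1\<close> and \<open>j\<close>; the two end
  equations have a second input in place of the missing link.\<close>

definition chain_lits :: "nat \<Rightarrow> (nat \<Rightarrow> 'v literal) \<Rightarrow> (nat \<Rightarrow> 'v) \<Rightarrow> nat \<Rightarrow> 'v literal list" where
  "chain_lits n y t j =
     (if j = 1 then [y 1, y 2, Pos (t 1)]
      else if j = n - 2 then [Pos (t (n - 3)), y (n - 1), y n]
      else [Pos (t (j - 1)), y (j + 1), Pos (t j)])"

definition node :: "nat \<Rightarrow> nat \<Rightarrow> nat" where
  "node n p = (if p = 1 then 1 else if p = n then n - 2 else p - 1)"

lemma linear_xor_chain_lits:
  assumes "4 \<le> n" "C \<in> linear_xor n y t"
  shows "\<exists>j\<in>{1..n-2}. C \<in> xor_cnf (chain_lits n y t j)"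
proof -
  consider "C \<in> xor_cnf [y 1, y 2, Pos (t 1)]"
    | j where "j \<in> {1..n-4}" "C \<in> xor_cnf [Pos (t j), y (j + 2), Pos (t (j + 1))]"
    | "C \<in> xor_cnf [Pos (t (n - 3)), y (n - 1), y n]"
    using assms(2) unfolding linear_xor_def by blast
  then show ?thesis
  proof cases
    case 1
    then show ?thesis using assms(1) by (intro bexI[of _ 1]) (auto simp: chain_lits_def)
  next
    case 2
    then show ?thesis by (intro bexI[of _ "j + 1"]) (auto simp: chain_lits_def)
  next
    case 3
    then show ?thesis using assms(1) by (intro bexI[of _ "n - 2"]) (auto simp: chain_lits_def)
  qed
qed

lemma node_preimage:
  assumes "4 \<le> n" "j \<in> {1..n-2}"
  shows "{p \<in> {1..n}. node n p = j} =
    (if j = 1 then {1, 2} else if j = n - 2 then {n - 1, n} else {j + 1})"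
  using assms by (auto simp: node_def split: if_splits)

lemma link_set:
  fixes n j :: nat
  assumes "4 \<le> n" "j \<in> {1..n-2}"
  shows "{i \<in> {1..n-3}. i = j \<or> i + 1 = j} =
    (if j = 1 then {1} else if j = n - 2 then {n - 3} else {j - 1, j})"
  using assms by (auto split: if_splits)

text \<open>At most one position of a chain is negated, so an odd number of negations in an equation
  just means that there is one.\<close>

lemma chain_lits:
  assumes n: "4 \<le> n" and j: "j \<in> {1..n-2}"
    and y: "\<And>p. atm (y p) = g p" and g: "inj_on g {1..n}"
    and t: "inj t" "\<And>i p. t i \<noteq> g p"
    and neg: "\<And>p q. y p \<in> range Neg \<Longrightarrow> y q \<in> range Neg \<Longrightarrow> p = q"
  shows "distinct (map atm (chain_lits n y t j))" (is ?distinct)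
    and "atm ` set (chain_lits n y t j) =
      t ` {i \<in> {1..n-3}. i = j \<or> i + 1 = j} \<union> g ` {p \<in> {1..n}. node n p = j}" (is ?atoms)
    and "odd (length (filter (\<lambda>l. l \<in> range Neg) (chain_lits n y t j))) \<longleftrightarrow>
      (\<exists>p\<in>{1..n}. node n p = j \<and> y p \<in> range Neg)" (is ?parity)
proof -
  have "n - 1 \<noteq> n" "{1, 2, n - 1, n} \<subseteq> {1..n}" using n by auto
  then have "g 1 \<noteq> g 2" "g (n - 1) \<noteq> g n"
    using inj_onD[OF g, of 1 2] inj_onD[OF g, of "n - 1" n] by auto
  then show ?distinct
    using n j t y inj_eq[OF t(1)] by (auto simp: chain_lits_def dest: sym)
  show ?atoms
    unfolding node_preimage[OF n j] link_set[OF n j] using y by (auto simp: chain_lits_def)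
  have "(\<exists>p\<in>{1..n}. node n p = j \<and> y p \<in> range Neg) \<longleftrightarrow>
      (\<exists>p\<in>(if j = 1 then {1, 2} else if j = n - 2 then {n - 1, n} else {j + 1}). y p \<in> range Neg)"
    unfolding node_preimage[OF n j, symmetric] by blast
  moreover have "\<not> (y 1 \<in> range Neg \<and> y 2 \<in> range Neg)"
    "\<not> (y (n - 1) \<in> range Neg \<and> y n \<in> range Neg)"
    using neg[of 1 2] neg[of "n - 1" n] n by auto
  moreover have "Pos v \<notin> range Neg" for v :: 'a by auto
  ultimately show ?parity by (simp add: chain_lits_def del: image_iff)
qed

text \<open>
  Equations are indexed by pairs \<open>(b, j)\<close>: the \<open>j\<close>-th equation of the first
  (\<open>b = False\<close>) or of the permuted (\<open>b = True\<close>) chain. The literal at position \<open>p\<close>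
  of a chain lies in its equation \<open>node n p\<close>.
\<close>
definition link_var :: "bool \<Rightarrow> nat \<Rightarrow> par_var" where
  "link_var b = (if b then TVar else SVar)"

definition incidence :: "nat \<Rightarrow> (nat \<Rightarrow> nat) \<Rightarrow> bool \<times> nat \<Rightarrow> par_var set" where
  "incidence n \<sigma> = (\<lambda>(b, j). link_var b ` {i \<in> {1..n-3}. i = j \<or> i + 1 = j} \<union>
     (\<lambda>p. XVar (if b then \<sigma> p else p)) ` {p \<in> {1..n}. node n p = j})"

text \<open>The equation containing the negated last variable is the only one with right-hand side
  1. As each variable occurs in two equations, this single odd charge makes the system
  contradictory.\<close>

definition charged :: "nat \<Rightarrow> (nat \<Rightarrow> nat) \<Rightarrow> (bool \<times> nat) set" where
  "charged n \<sigma> = {(True, node n p) | p. p \<in> {1..n} \<and> \<sigma> p = n}"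

lemma rPar_equation:
  assumes n: "4 \<le> n" and \<sigma>: "\<sigma> permutes {1..n}" and C: "C \<in> rPar n \<sigma>"
  shows "\<exists>v\<in>UNIV \<times> {1..n-2}. \<exists>ys. C \<in> xor_cnf ys \<and> length ys = 3 \<and> distinct (map atm ys) \<and>
    atm ` set ys = incidence n \<sigma> v \<and>
    (odd (length (filter (\<lambda>l. l \<in> range Neg) ys)) \<longleftrightarrow> v \<in> charged n \<sigma>)"
proof -
  have len: "length (chain_lits n y t j) = 3" for y :: "nat \<Rightarrow> par_var literal" and t j
    by (simp add: chain_lits_def)
  consider "C \<in> linear_xor n (\<lambda>i. Pos (XVar i)) SVar"
    | "C \<in> linear_xor n (\<lambda>i. if \<sigma> i = n then Neg (XVar (\<sigma> i)) else Pos (XVar (\<sigma> i))) TVar"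
    using C by (auto simp: rPar_def Parity_def)
  then show ?thesis
  proof cases
    case 1
    define y where "y i = Pos (XVar i)" for i
    obtain j where j: "j \<in> {1..n-2}" "C \<in> xor_cnf (chain_lits n y SVar j)"
      using linear_xor_chain_lits[OF n] 1 unfolding y_def by blast
    have "inj SVar" "inj_on XVar {1..n}" "\<And>p. atm (y p) = XVar p"
      by (auto simp: inj_on_def y_def)
    moreover have "y p \<notin> range Neg" for p by (auto simp: y_def)
    ultimately have "distinct (map atm (chain_lits n y SVar j))"
      "atm ` set (chain_lits n y SVar j) =
         SVar ` {i \<in> {1..n-3}. i = j \<or> i + 1 = j} \<union> XVar ` {p \<in> {1..n}. node n p = j}"
      "even (length (filter (\<lambda>l. l \<in> range Neg) (chain_lits n y SVar j)))"
      using chain_lits[OF n j(1), of y XVar SVar] by auto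
    then show ?thesis
      using j len
      by (intro bexI[of _ "(False, j)"] exI[of _ "chain_lits n y SVar j"])
        (auto simp: incidence_def link_var_def charged_def)
  next
    case 2
    define y where "y i = (if \<sigma> i = n then Neg (XVar (\<sigma> i)) else Pos (XVar (\<sigma> i)))" for i
    obtain j where j: "j \<in> {1..n-2}" "C \<in> xor_cnf (chain_lits n y TVar j)"
      using linear_xor_chain_lits[OF n] 2 unfolding y_def by blast
    have neg: "y p \<in> range Neg \<longleftrightarrow> \<sigma> p = n" for p by (auto simp: y_def)
    have g: "inj_on (\<lambda>p. XVar (\<sigma> p)) {1..n}"
      using permutes_inj[OF \<sigma>] by (auto simp: inj_on_def)
    have lits: "distinct (map atm (chain_lits n y TVar j))"
      "atm ` set (chain_lits n y TVar j) = TVar ` {i \<in> {1..n-3}. i = j \<or> i + 1 = j} \<union>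
         (\<lambda>p. XVar (\<sigma> p)) ` {p \<in> {1..n}. node n p = j}"
      "odd (length (filter (\<lambda>l. l \<in> range Neg) (chain_lits n y TVar j))) \<longleftrightarrow>
        (\<exists>p\<in>{1..n}. node n p = j \<and> y p \<in> range Neg)"
    proof -
      have 1: "atm (y p) = XVar (\<sigma> p)" for p by (simp add: y_def)
      have 2: "p = q" if "y p \<in> range Neg" "y q \<in> range Neg" for p q
        using that permutes_inj[OF \<sigma>] unfolding neg by (metis injD)
      have 3: "inj TVar" by (simp add: inj_def)
      have 4: "TVar i \<noteq> XVar (\<sigma> p)" for i p by simp
      note * = chain_lits[OF n j(1) 1 g 3 4 2]
      show "distinct (map atm (chain_lits n y TVar j))" by (rule *(1))
      show "atm ` set (chain_lits n y TVar j) = TVar ` {i \<in> {1..n-3}. i = j \<or> i + 1 = j} \<union>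
        (\<lambda>p. XVar (\<sigma> p)) ` {p \<in> {1..n}. node n p = j}" by (rule *(2))
      show "odd (length (filter (\<lambda>l. l \<in> range Neg) (chain_lits n y TVar j))) \<longleftrightarrow>
        (\<exists>p\<in>{1..n}. node n p = j \<and> y p \<in> range Neg)" by (rule *(3))
    qed
    have charged: "(True, j) \<in> charged n \<sigma> \<longleftrightarrow> (\<exists>p\<in>{1..n}. node n p = j \<and> y p \<in> range Neg)"
      unfolding neg charged_def by blast
    have incidence: "incidence n \<sigma> (True, j) = TVar ` {i \<in> {1..n-3}. i = j \<or> i + 1 = j} \<union>
        (\<lambda>p. XVar (\<sigma> p)) ` {p \<in> {1..n}. node n p = j}"
      by (simp add: incidence_def link_var_def)
    show ?thesis
      by (intro bexI[of _ "(True, j)"] exI[of _ "chain_lits n y TVar j"] conjI)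
        (use j len lits charged incidence in simp_all)
  qed
qed

lemma odd_card_Int_pair:
  assumes "a \<noteq> b"
  shows "odd (card (U \<inter> {a, b})) \<longleftrightarrow> (a \<in> U) \<noteq> (b \<in> U)"
proof -
  have "U \<inter> {a, b} = (if a \<in> U then {a} else {}) \<union> (if b \<in> U then {b} else {})" by auto
  then show ?thesis using assms by (auto split: if_splits)
qed

section \<open>Boundaries of vertex sets in terms of positions\<close>

text \<open>Positions, unlike vertices, are what \<open>\<sigma>\<close> acts on, so the two chains
  can be compared after this translation.\<close>

definition covered :: "nat \<Rightarrow> bool \<Rightarrow> (bool \<times> nat) set \<Rightarrow> nat set" where
  "covered n b U = {p \<in> {1..n}. (b, node n p) \<in> U}"

lemma link_var_in_boundary:
  assumes "i \<in> {1..n-3}"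
  shows "link_var b i \<in> boundary (incidence n \<sigma>) U \<longleftrightarrow> ((b, i) \<in> U) \<noteq> ((b, i + 1) \<in> U)"
proof -
  have "{v \<in> U. link_var b i \<in> incidence n \<sigma> v} = U \<inter> {(b, i), (b, i + 1)}"
    using assms by (auto simp: incidence_def link_var_def split: if_splits)
  then show ?thesis by (simp add: boundary_def odd_card_Int_pair del: Int_insert_right)
qed

lemma XVar_in_boundary:
  assumes \<sigma>: "\<sigma> permutes {1..n}" and "i \<in> {1..n}"
  shows "XVar i \<in> boundary (incidence n \<sigma>) U \<longleftrightarrow>
    i \<in> sym_diff (covered n False U) (\<sigma> ` covered n True U)"
proof -
  define p where "p = inv \<sigma> i"
  have p: "p \<in> {1..n}" "\<sigma> p = i"
    using assms(2) permutes_in_image[OF permutes_inv[OF \<sigma>], of i] permutes_inverses(1)[OF \<sigma>]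
    by (simp_all add: p_def)
  have uniq: "i = \<sigma> q \<longleftrightarrow> q = p" for q using p(2) permutes_inj[OF \<sigma>] by (metis injD)
  have "XVar i \<in> incidence n \<sigma> (b, j) \<longleftrightarrow> j = node n (if b then p else i)" for b j
    using assms(2) p(1) uniq by (cases b) (auto simp: incidence_def link_var_def image_iff)
  then have "{v \<in> U. XVar i \<in> incidence n \<sigma> v} = U \<inter> {(False, node n i), (True, node n p)}"
    by (auto split: if_splits)
  then have "XVar i \<in> boundary (incidence n \<sigma>) U \<longleftrightarrow>
      ((False, node n i) \<in> U) \<noteq> ((True, node n p) \<in> U)"
    by (simp add: boundary_def odd_card_Int_pair del: Int_insert_right)
  moreover have "i \<in> \<sigma> ` covered n True U \<longleftrightarrow> (True, node n p) \<in> U"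
    using p uniq by (auto simp: covered_def image_iff)
  ultimately show ?thesis using assms(2) by (auto simp: covered_def)
qed

text \<open>Link \<open>i\<close> joins the nodes of positions \<open>i + 1\<close> and
  \<open>i + 2\<close>. Positions 2 and \<open>n\<close> never jump, sharing a node with their
  predecessor; a jump at 1 corresponds to no link and causes the \<open>+ 1\<close> in later
  bounds.\<close>

lemma jumps_covered_subset:
  assumes "4 \<le> n"
  shows "jumps n (covered n b U) \<subseteq>
    insert 1 ((\<lambda>i. i + 2) ` {i \<in> {1..n-3}. link_var b i \<in> boundary (incidence n \<sigma>) U})"
proof
  fix p assume p: "p \<in> jumps n (covered n b U)"
  show "p \<in> insert 1 ((\<lambda>i. i + 2) ` {i \<in> {1..n-3}. link_var b i \<in> boundary (incidence n \<sigma>) U})"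
  proof (cases "p = 1")
    case False
    then have "((b, node n (p - 1)) \<in> U) \<noteq> ((b, node n p) \<in> U)" "p \<in> {2..n}"
      using p by (auto simp: jumps_def covered_def)
    moreover have "node n 1 = 1" "node n 2 = 1" "node n (n - 1) = n - 2" "node n n = n - 2"
      using assms by (auto simp: node_def)
    moreover from calculation have "p \<noteq> 2" "p \<noteq> n" by auto
    moreover obtain r where r: "p = r + 2"
      using \<open>p \<in> {2..n}\<close> by (metis add.commute atLeastAtMost_iff le_Suc_ex)
    ultimately have "r \<in> {1..n-3}" "((b, r) \<in> U) \<noteq> ((b, r + 1) \<in> U)"
      by (auto simp: node_def)
    then show ?thesis using link_var_in_boundary r by blast
  qed simp
qed

lemma card_jumps_covered:
  assumes "4 \<le> n" "finite (boundary (incidence n \<sigma>) U)"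
  shows "card (jumps n (covered n b U)) \<le> card (boundary (incidence n \<sigma>) U) + 1"
proof -
  define I where "I = {i \<in> {1..n-3}. link_var b i \<in> boundary (incidence n \<sigma>) U}"
  have I: "finite I" by (simp add: I_def)
  have "inj (link_var b)" by (auto simp: link_var_def inj_on_def)
  then have "card I = card (link_var b ` I)" by (metis card_image inj_on_subset subset_UNIV)
  also have "\<dots> \<le> card (boundary (incidence n \<sigma>) U)"
    using assms(2) by (intro card_mono) (auto simp: I_def)
  finally have "card I \<le> card (boundary (incidence n \<sigma>) U)" .
  moreover have "card (jumps n (covered n b U)) \<le> card (insert 1 ((\<lambda>i. i + 2) ` I))"
    using jumps_covered_subset[OF assms(1), of b U \<sigma>] I
    unfolding I_def[symmetric] by (intro card_mono) auto
  moreover have "card (insert 1 ((\<lambda>i. i + 2) ` I)) \<le> card I + 1"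
    using I card_image_le[OF I, of "\<lambda>i. i + 2"] by (simp add: card_insert_if)
  ultimately show ?thesis by linarith
qed

lemma card_sym_diff_covered:
  assumes "\<sigma> permutes {1..n}" "finite (boundary (incidence n \<sigma>) U)"
  shows "card (sym_diff (covered n False U) (\<sigma> ` covered n True U)) \<le>
    card (boundary (incidence n \<sigma>) U)"
proof -
  define D where "D = sym_diff (covered n False U) (\<sigma> ` covered n True U)"
  have "D \<subseteq> {1..n}"
    using permutes_image[OF assms(1)] by (auto simp: D_def covered_def)
  then have "XVar ` D \<subseteq> boundary (incidence n \<sigma>) U"
    using XVar_in_boundary[OF assms(1)] unfolding D_def by blast
  then have "card (XVar ` D) \<le> card (boundary (incidence n \<sigma>) U)" by (intro card_mono assms(2))
  moreover have "card (XVar ` D) = card D" by (intro card_image) (auto simp: inj_on_def)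
  ultimately show ?thesis by (simp add: D_def)
qed

text \<open>Equation \<open>j\<close> always holds position \<open>j + 1\<close>; only positions 1
  and \<open>n\<close> come in addition, at most two per chain.\<close>

lemma card_covered:
  assumes "4 \<le> n" "U \<subseteq> UNIV \<times> {1..n-2}"
  shows "card U \<le> card (covered n False U) + card (covered n True U)"
    and "card (covered n False U) + card (covered n True U) \<le> card U + 4"
proof -
  define A where "A b = {j. (b, j) \<in> U}" for b
  have A: "A b \<subseteq> {1..n-2}" for b using assms(2) by (auto simp: A_def)
  then have fin: "finite (A b)" for b using finite_subset by blast
  have "U = Pair False ` A False \<union> Pair True ` A True"
  proof -
    have "(b, j) \<in> U \<longleftrightarrow> (b, j) \<in> Pair False ` A False \<union> Pair True ` A True" for b j
      by (cases b) (auto simp: A_def)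
    then show ?thesis by auto
  qed
  moreover have "card (Pair False ` A False \<union> Pair True ` A True) = card (A False) + card (A True)"
    using fin by (subst card_Un_disjoint) (auto simp: card_image inj_on_def)
  ultimately have U: "card U = card (A False) + card (A True)" by simp
  have card_shift: "card ((\<lambda>j. j + 1) ` A b) = card (A b)" for b by (simp add: card_image)
  have "(\<lambda>j. j + 1) ` A b \<subseteq> covered n b U" for b
  proof
    fix p assume "p \<in> (\<lambda>j. j + 1) ` A b"
    then obtain j where "p = j + 1" "(b, j) \<in> U" "j \<in> {1..n-2}" using A[of b] unfolding A_def by blast
    then show "p \<in> covered n b U" by (auto simp: covered_def node_def)
  qed
  then have lower: "card (A b) \<le> card (covered n b U)" for b
    using card_mono[of "covered n b U" "(\<lambda>j. j + 1) ` A b"] card_shift[of b] by (simp add: covered_def)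
  have "covered n b U \<subseteq> {1, n} \<union> (\<lambda>j. j + 1) ` A b" for b
  proof
    fix p assume p: "p \<in> covered n b U"
    show "p \<in> {1, n} \<union> (\<lambda>j. j + 1) ` A b"
    proof (cases "p = 1 \<or> p = n")
      case False
      then have "p - 1 \<in> A b" "p = p - 1 + 1" using p by (auto simp: covered_def node_def A_def)
      then show ?thesis by blast
    qed auto
  qed
  then have "card (covered n b U) \<le> card ({1, n} \<union> (\<lambda>j. j + 1) ` A b)" for b
    using fin by (intro card_mono) auto
  moreover have "card ({1, n} \<union> (\<lambda>j. j + 1) ` A b) \<le> 2 + card (A b)" for b
    using card_Un_le[of "{1, n}" "(\<lambda>j. j + 1) ` A b"] card_shift[of b] assms(1) by simp
  ultimately have upper: "card (covered n b U) \<le> 2 + card (A b)" for b using le_trans by blast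
  show "card U \<le> card (covered n False U) + card (covered n True U)"
    using lower[of False] lower[of True] U by simp
  show "card (covered n False U) + card (covered n True U) \<le> card U + 4"
    using upper[of False] upper[of True] U by simp
qed

text \<open>A boundary of size at most \<open>K\<close> lets the covered parts \<open>X\<close> and
  \<open>Y\<close> differ in size by at most \<open>K\<close>. A set \<open>U\<close> of medium size
  then has \<open>card Y\<close> between \<open>k\<close> and \<open>n - k\<close>: the first
  inequality on \<open>s\<close> gives the lower bound, the second the upper one, and
  \<open>\<sigma>\<close> would be bad. Sets with empty boundary are handled by connectedness of the
  graph.\<close>

lemma expanding_system_rPar:
  assumes n: "4 \<le> n" and \<sigma>: "\<sigma> permutes {1..n}"
    and good: "\<sigma> \<notin> bad_permutations n (K + 1) k"
    and s: "1 \<le> s" "2 * k + K \<le> s" "2 * s + 2 * k + K + 4 \<le> 2 * n"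
  shows "expanding_system (UNIV \<times> {1..n-2}) (incidence n \<sigma>) s K"
proof
  show "finite (UNIV \<times> {1..n-2} :: (bool \<times> nat) set)" by simp
  show "1 \<le> s" by fact
next
  fix U :: "(bool \<times> nat) set"
  assume U: "U \<subseteq> UNIV \<times> {1..n-2}" and fin: "finite (boundary (incidence n \<sigma>) U)"
    and K: "card (boundary (incidence n \<sigma>) U) \<le> K"
  define X where "X = covered n False U"
  define Y where "Y = covered n True U"
  have sub: "X \<subseteq> {1..n}" "Y \<subseteq> {1..n}" by (auto simp: X_def Y_def covered_def)
  then have finXY: "finite X" "finite Y" using finite_subset by auto
  have jumps: "card (jumps n X) \<le> K + 1" "card (jumps n Y) \<le> K + 1"
    using card_jumps_covered[OF n fin] K unfolding X_def Y_def by (meson add_le_mono1 le_trans)+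
  have diff: "card (sym_diff X (\<sigma> ` Y)) \<le> K"
    using card_sym_diff_covered[OF \<sigma> fin] K by (simp add: X_def Y_def)
  have "card (\<sigma> ` Y) = card Y"
    using permutes_inj[OF \<sigma>] by (metis card_image inj_on_subset subset_UNIV)
  moreover have "card X \<le> card (\<sigma> ` Y \<union> sym_diff X (\<sigma> ` Y))"
    "card (\<sigma> ` Y) \<le> card (X \<union> sym_diff X (\<sigma> ` Y))"
    using finXY by (auto intro!: card_mono)
  ultimately have XY: "card X \<le> card Y + K" "card Y \<le> card X + K"
    using card_Un_le[of "\<sigma> ` Y" "sym_diff X (\<sigma> ` Y)"] card_Un_le[of X "sym_diff X (\<sigma> ` Y)"] diff
    by linarith+
  show "card U \<le> s \<or> 2 * s < card U"
  proof (rule ccontr)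
    assume "\<not> ?thesis"
    then have "k \<le> card Y" "card Y + k \<le> n"
      using card_covered[OF n U] XY s unfolding X_def Y_def by linarith+
    then have "\<sigma> \<in> bad_permutations n (K + 1) k"
      unfolding bad_permutations_def using \<sigma> sub jumps le_trans[OF diff, of "K + 1"] by auto
    then show False using good by contradiction
  qed
next
  fix U :: "(bool \<times> nat) set"
  assume U: "U \<subseteq> UNIV \<times> {1..n-2}" "card U \<le> s" and empty: "boundary (incidence n \<sigma>) U = {}"
  \<comment> \<open>Only position 1 can be a jump, and \<open>{}\<close> and \<open>{1..n}\<close>
    are the sets with jumps \<open>{}\<close> and \<open>{1}\<close>.\<close>
  have all_or_none: "covered n b U = {} \<or> covered n b U = {1..n}" for b
  proof -
    have "jumps n (covered n b U) \<subseteq> {1}"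
      using jumps_covered_subset[OF n, of b U \<sigma>] empty by auto
    moreover have "jumps n {} = {}" "jumps n {1..n} = {1}" using n by (auto simp: jumps_def)
    moreover have "covered n b U \<in> Pow {1..n}" by (auto simp: covered_def)
    ultimately show ?thesis using inj_on_jumps[of n] by (metis PowI empty_subsetI inj_onD order_refl subset_singletonD)
  qed
  have "card (sym_diff (covered n False U) (\<sigma> ` covered n True U)) = 0"
    using card_sym_diff_covered[OF \<sigma>, of U] empty by simp
  moreover have "finite (sym_diff (covered n False U) (\<sigma> ` covered n True U))"
    by (simp add: covered_def)
  ultimately have "covered n False U = \<sigma> ` covered n True U" by auto
  then have same: "covered n False U = covered n True U"
    using all_or_none[of True] permutes_image[OF \<sigma>] by auto
  have "covered n True U \<noteq> {1..n}"
    using card_covered(2)[OF n U(1)] U(2) s n unfolding same by auto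
  then have "card U = 0" using all_or_none[of True] card_covered(1)[OF n U(1)] same by simp
  moreover have "finite U" using U(1) by (rule finite_subset) simp
  ultimately show "U = {}" by simp
qed

lemma rPar_refutation_length:
  assumes n: "4 \<le> n" and \<sigma>: "\<sigma> permutes {1..n}"
    and good: "\<sigma> \<notin> bad_permutations n (K + 1) k"
    and s: "1 \<le> s" "2 * k + K \<le> s" "2 * s + 2 * k + K + 4 \<le> 2 * n"
    and q: "2 * q + 3 \<le> K" and ref: "resolution_refutation (rPar n \<sigma>) \<pi>"
  shows "exp (real q * real q / (6 * real n)) \<le> real (length \<pi>)"
proof -
  interpret expanding_system "UNIV \<times> {1..n-2}" "incidence n \<sigma>" "charged n \<sigma>" s K
    using expanding_system_rPar[OF n \<sigma> good s] .
  interpret W: winning_positions "rPar n \<sigma>" positions K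
    using rPar_equation[OF n \<sigma>] by (intro winning_positions) blast
  \<comment> \<open>The links get the full range \<open>{1..n}\<close>, larger than the one that
    occurs, to make the number of literals exactly \<open>6 * n\<close>.\<close>
  define vars where "vars = XVar ` {1..n} \<union> SVar ` {1..n} \<union> TVar ` {1..n}"
  define L where "L = Pos ` vars \<union> Neg ` vars"
  have "finite vars" by (simp add: vars_def)
  moreover have "card vars = 3 * n"
    unfolding vars_def by (subst card_Un_disjoint; auto simp: card_image inj_on_def card_Un_disjoint)+
  moreover have "card L = card vars + card vars"
    unfolding L_def using \<open>finite vars\<close>
    by (subst card_Un_disjoint; auto simp: card_image inj_on_def)
  ultimately have L: "card L = 6 * n" "finite L" by (auto simp: L_def)
  have clause: "C \<subseteq> L \<and> card C \<le> 3" if C: "C \<in> rPar n \<sigma>" for C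
  proof -
    obtain v ys where ys: "C \<in> xor_cnf ys" "length ys = 3" "atm ` set ys = incidence n \<sigma> v"
      using rPar_equation[OF n \<sigma> C] by blast
    obtain bs where bs: "C = signed bs ys" "length bs = 3" using ys by (auto simp: xor_cnf_def)
    have "incidence n \<sigma> v \<subseteq> vars"
      using permutes_in_image[OF \<sigma>] by (cases v) (auto simp: incidence_def link_var_def vars_def)
    have "l \<in> L" if "l \<in> C" for l
    proof -
      have "atm (neg_lit y) = atm y" for y :: "par_var literal" by (cases y) auto
      then have "atm l \<in> atm ` set ys"
        using that bs by (auto simp: signed_def dest: set_zip_rightD split: if_splits)
      then have "atm l \<in> vars" using ys(3) \<open>incidence n \<sigma> v \<subseteq> vars\<close> by blast
      then show ?thesis by (cases l) (auto simp: L_def)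
    qed
    moreover have "card C \<le> 3"
      using card_length[of "map2 (\<lambda>b y. if b then neg_lit y else y) bs ys"] bs ys(2)
      by (simp add: signed_def)
    ultimately show ?thesis by blast
  qed
  have "exp (real q * real q / real (card L)) \<le> real (length \<pi>)"
  proof (rule W.refutation_length_ge[OF ref])
    show "L \<noteq> {}" using L n by auto
    show "q \<le> card L" using L s q by simp
  qed (use clause L q in auto)
  then show ?thesis by (simp add: L)
qed

section \<open>Random reorderings\<close>

text \<open>Binary exponents per unit of \<open>n\<close>: the three small sets cost 18/300 from the
  powers of 64 and 3/40 from those of \<open>65 / 64\<close>, as
  \<open>(65 / 64) ^ 40 \<le> 2\<close>; the prescribed image gains 1/4. The balance is below -1/10,
  and rounding \<open>m\<close> and \<open>k\<close> costs \<open>2 ^ 19\<close>.\<close>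

lemma prob_bad_permutations_le:
  "measure_pmf.prob (pmf_of_set {\<sigma>. \<sigma> permutes {1..n}}) (bad_permutations n (n div 300 + 1) (n div 4))
    \<le> 2 ^ 19 * (2 powr - (1 / 10)) ^ n"
proof -
  define m where "m = n div 300 + 1"
  define k where "k = n div 4"
  define S where "S = {\<sigma>. \<sigma> permutes {1..n}}"
  have "id \<in> S" by (simp add: S_def permutes_id)
  then have "S \<noteq> {}" by blast
  moreover have "finite S" "card S = fact n"
    by (simp_all add: S_def finite_permutations card_permutations)
  ultimately have S: "finite S" "S \<noteq> {}" "card S = fact n" by simp_all
  have "measure_pmf.prob (pmf_of_set S) (bad_permutations n m k) =
      real (card (bad_permutations n m k)) / fact n"
  proof -
    have "S \<inter> bad_permutations n m k = bad_permutations n m k"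
      by (auto simp: S_def bad_permutations_def)
    then show ?thesis using measure_pmf_of_set[OF S(2,1)] S(3) by simp
  qed
  also have "\<dots> \<le> (64 ^ m * (65 / 64) ^ n) ^ 3 * (fact n / 2 ^ k) / fact n"
    using card_bad_permutations[of n m k]
    by (intro divide_right_mono) auto
  also have "\<dots> = (64 ^ m) ^ 3 * ((65 / 64) ^ n) ^ 3 / 2 ^ k"
    by (simp add: power_mult_distrib)
  also have "\<dots> \<le>
      2 powr (18 * (real n / 300 + 1)) * 2 powr (3 * real n / 40) / 2 powr (real n / 4 - 1)"
  proof (intro frac_le mult_mono)
    have "(64 ^ m) ^ 3 = (((2 :: real) ^ 6) ^ m) ^ 3" by simp
    also have "\<dots> = 2 ^ (6 * m * 3)" by (simp only: power_mult)
    also have "6 * m * 3 = 18 * m" by simp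
    also have "(2 :: real) ^ (18 * m) = 2 powr real (18 * m)" by (rule powr_realpow[symmetric]) simp
    also have "\<dots> \<le> 2 powr (18 * (real n / 300 + 1))"
    proof -
      have "real (n div 300) \<le> real n / 300" by linarith
      then show ?thesis by (simp add: m_def)
    qed
    finally show "(64 ^ m) ^ 3 \<le> 2 powr (18 * (real n / 300 + 1))" .
    have "(65 / 64 :: real) = ((65 / 64) powr 40) powr (1 / 40)" by (subst powr_powr) simp
    also have "(65 / 64 :: real) powr 40 = (65 / 64) ^ 40" by (rule powr_numeral) simp
    also have "((65 / 64 :: real) ^ 40) powr (1 / 40) \<le> 2 powr (1 / 40)"
      by (intro powr_mono2) (simp_all add: power_divide)
    finally have "((65 / 64) ^ n) ^ 3 \<le> ((2 powr (1 / 40)) ^ n :: real) ^ 3"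
      by (intro power_mono) auto
    also have "\<dots> = 2 powr (1 / 40 * real (n * 3))"
      by (simp only: power_mult[symmetric] powr_power) (simp add: mult.commute)
    also have "\<dots> = 2 powr (3 * real n / 40)" by (simp add: mult.commute)
    finally show "((65 / 64) ^ n) ^ 3 \<le> 2 powr (3 * real n / 40)" .
    have "real n / 4 - 1 \<le> real k" unfolding k_def by linarith
    then have "2 powr (real n / 4 - 1) \<le> 2 powr real k" by simp
    then show "2 powr (real n / 4 - 1) \<le> (2 :: real) ^ k" by (simp add: powr_realpow)
  qed auto
  also have "\<dots> = 2 powr (18 * (real n / 300 + 1) + 3 * real n / 40 - (real n / 4 - 1))"
    by (simp only: powr_add powr_diff)
  also have "\<dots> \<le> 2 powr (19 + - (1 / 10) * real n)" by (intro powr_mono) auto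
  also have "\<dots> = 2 ^ 19 * (2 powr - (1 / 10)) ^ n"
    by (simp only: powr_add powr_powr[symmetric] powr_realpow powr_gt_zero) (simp add: powr_realpow)
  finally show ?thesis by (simp add: S_def m_def k_def)
qed

text \<open>The constant is \<open>(1 / 2000)^2 / 6\<close>: \<open>q\<close>, at least
  \<open>n / 2000\<close>, serves both as size of the restriction and as width, and there are
  \<open>6 * n\<close> literals.\<close>

lemma good_permutation_refutation_length:
  assumes n: "4000 \<le> n" and \<sigma>: "\<sigma> permutes {1..n}"
    and good: "\<sigma> \<notin> bad_permutations n (n div 300 + 1) (n div 4)"
    and ref: "resolution_refutation (rPar n \<sigma>) \<pi>"
  shows "2 powr (1 / 24000000 * real n) \<le> real (length \<pi>)"
proof -
  define q where "q = n div 1000"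
  have q: "real n / 2000 \<le> real q" using n unfolding q_def by linarith
  have "2 powr (1 / 24000000 * real n) = exp (1 / 24000000 * real n * ln 2)"
    by (simp add: powr_def)
  also have "\<dots> \<le> exp (1 / 24000000 * real n * 1)"
    using ln_2_less_1 by (simp del: mult_1_right) (simp add: mult_left_le)
  also have "\<dots> = exp (real n / 2000 * (real n / 2000) / (6 * real n))"
    using n by simp
  also have "\<dots> \<le> exp (real q * real q / (6 * real n))"
    using q by (simp only: exp_le_cancel_iff) (intro divide_right_mono mult_mono, auto)
  also have "\<dots> \<le> real (length \<pi>)"
  \<comment> \<open>This \<open>s\<close> is about a third of the roughly \<open>2 * n\<close>
    vertices, so sets with between \<open>s\<close> and \<open>2 * s\<close> vertices and their
    complements are both of linear size.\<close>
  proof (rule rPar_refutation_length[OF _ \<sigma> good _ _ _ _ ref, of "2 * n div 3"])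
    show "2 * q + 3 \<le> n div 300" using n unfolding q_def by linarith
    show "2 * (n div 4) + n div 300 \<le> 2 * n div 3" using n by linarith
    show "2 * (2 * n div 3) + 2 * (n div 4) + n div 300 + 4 \<le> 2 * n" using n by linarith
  qed (use n in auto)
  finally show ?thesis .
qed

theorem theorem1:
  shows "\<exists>\<alpha>::real. \<alpha> > 0 \<and>
    (\<lambda>n::nat. measure_pmf.prob (pmf_of_set {\<sigma>. \<sigma> permutes {1..n}})
       {\<sigma>. \<forall>\<pi>. resolution_refutation (rPar n \<sigma>) \<pi> \<longrightarrow>
              2 powr (\<alpha> * real n) \<le> real (length \<pi>)}) \<longlonglongrightarrow> 1"
proof (intro exI[of _ "1 / 24000000"] conjI)
  define hard where "hard n = {\<sigma>. \<forall>\<pi>. resolution_refutation (rPar n \<sigma>) \<pi> \<longrightarrow>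
    2 powr (1 / 24000000 * real n) \<le> real (length \<pi>)}" for n
  define p where "p n = pmf_of_set {\<sigma>. \<sigma> permutes {1..n::nat}}" for n
  have lower: "1 - 2 ^ 19 * (2 powr - (1 / 10)) ^ n \<le> measure_pmf.prob (p n) (hard n)"
    if "4000 \<le> n" for n
  proof -
    define B where "B = bad_permutations n (n div 300 + 1) (n div 4)"
    have set_p: "set_pmf (p n) = {\<sigma>. \<sigma> permutes {1..n}}"
      unfolding p_def
    proof (rule set_pmf_of_set)
      have "id \<in> {\<sigma>. \<sigma> permutes {1..n}}" by (simp add: permutes_id)
      then show "{\<sigma>. \<sigma> permutes {1..n}} \<noteq> {}" by blast
    qed (simp add: finite_permutations)
    have "1 - 2 ^ 19 * (2 powr - (1 / 10)) ^ n \<le> 1 - measure_pmf.prob (p n) B"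
      using prob_bad_permutations_le[of n] by (simp add: B_def p_def)
    also have "\<dots> = measure_pmf.prob (p n) (- B)"
      using measure_pmf.prob_compl[of B "p n"] by (simp add: Compl_eq_Diff_UNIV)
    also have "\<dots> \<le> measure_pmf.prob (p n) (hard n)"
    \<comment> \<open>The complement of \<open>B\<close> also contains functions that are not
      permutations, so the inclusion is shown only on the support.\<close>
    proof (rule measure_pmf.finite_measure_mono_AE)
      show "AE \<sigma> in measure_pmf (p n). \<sigma> \<in> - B \<longrightarrow> \<sigma> \<in> hard n"
        using good_permutation_refutation_length[OF that]
        by (auto simp: AE_measure_pmf_iff set_p hard_def B_def)
    qed simp
    finally show ?thesis .
  qed
  have "(\<lambda>n. 1 - 2 ^ 19 * (2 powr - (1 / 10)) ^ n) \<longlonglongrightarrow> (1 - 2 ^ 19 * 0 :: real)"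
    by (intro tendsto_intros LIMSEQ_power_zero) (simp add: powr_less_one)
  then have lim: "(\<lambda>n. 1 - 2 ^ 19 * (2 powr - (1 / 10)) ^ n :: real) \<longlonglongrightarrow> 1" by simp
  have "(\<lambda>n. measure_pmf.prob (p n) (hard n)) \<longlonglongrightarrow> 1"
  proof (rule tendsto_sandwich[OF _ _ lim tendsto_const])
    show "\<forall>\<^sub>F n in sequentially.
        1 - 2 ^ 19 * (2 powr - (1 / 10)) ^ n \<le> measure_pmf.prob (p n) (hard n)"
      using lower by (rule eventually_sequentiallyI)
  qed simp
  then show "(\<lambda>n::nat. measure_pmf.prob (pmf_of_set {\<sigma>. \<sigma> permutes {1..n}})
       {\<sigma>. \<forall>\<pi>. resolution_refutation (rPar n \<sigma>) \<pi> \<longrightarrow>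
              2 powr (1 / 24000000 * real n) \<le> real (length \<pi>)}) \<longlonglongrightarrow> 1"
    by (simp only: p_def hard_def)
qed simp

end
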